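(* Suppose that $(L_1,L_2,R,\alpha,\pi)$ satisfies assumptions (a), (b), (c) listed in the context. Then the algebra $\tilde{M}=\tilde{M}(L_1,L_2,R,\alpha,\pi)$ is a left central Leibniz algebra with radical $R$ (where $R$ is identified with $(R\oplus R)/D\subseteq\tilde M$ via $a\mapsto (a,0)+D$).
   Context: All algebras are finite-dimensional over $\mathbb{C}$. A left Leibniz algebra is a $\mathbb{C}$-algebra $M$ with product $[\ ]$ satisfying $[a[bc]]=[[ab]c]+[b[ac]]$ for all $a,b,c\in M$; it is left central if also $[a[bb]]=0$ for all $a,b\in M$. The radical of a left Leibniz algebra $M$ is $\{x\in M\mid \psi(x,a)=0\ \text{for all}\ a\in M\}$, where $\psi(a,b)=[ab]+[ba]$. Assumptions on the data $(L_1,L_2,R,\alpha,\pi)$: (a) $L_1,L_2$ are Lie algebras with a common ideal $R$ (i.e. $R$ is a Lie algebra that is an ideal of both), and $L_2/R$ is abelian. Set $Z:=R\cap Z(L_1)\cap Z(L_2)$, where $Z(L_i)$ is the center of $L_i$. (b) $\alpha:L_1\to \mathrm{Der}(L_2)$ is a morphism of Lie algebras; write $\alpha(x)(y)=x.y$ for $x\in L_1$, $y\in L_2$. It is required that $x.y=[xy]$ whenever $x\in R$ (bracket in $L_2$) or $y\in R$ (bracket in $L_1$). (c) $\pi:L_1/R\to \mathrm{Hom}_{\mathbb{C}}(L_2/R,Z)$ is an injective morphism of left $L_1$-modules such that no nonzero element of $L_2/R$ is annihilated by all of $\mathrm{im}\,\pi$. Here $L_1$ acts on $L_1/R$ by the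 adjoint action, on $L_2/R$ via $\alpha$, trivially on $Z$, and on $\mathrm{Hom}_{\mathbb{C}}(L_2/R,Z)$ by the induced action $(x.f)(v)=-f(x.v)$. Set $\psi'(x,y):=\pi(x+R)(y+R)\in Z$ for $x\in L_1$, $y\in L_2$. Let $M=M(L_1,L_2,R,\alpha,\pi)$ be the vector space $L_1\oplus L_2$ with product $$[(x_1,y_1)(x_2,y_2)]:=\big([x_1x_2],\ x_1.y_2-x_2.y_1+[y_1y_2]+\psi'(x_2,y_1)\big).$$ Then $D:=\{(a,-a)\mid a\in R\}$ is a $2$-sided ideal of $M$, and $\tilde{M}(L_1,L_2,R,\alpha,\pi):=M/D$. *)

theory Defs
  imports Complex_Main "HOL-Algebra.Module" "HOL-Algebra.QuotRing" "HOL-Algebra.Algebraic_Closure_Type"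
begin

text \<open>
  A (nonassociative) algebra over the complex numbers is a record of type
  \<^typ>\<open>(complex, 'a) module\<close>: the field \<open>mult\<close>, written \<open>\<otimes>\<close>, is the product \<open>[ ]\<close>,
  and the field \<open>one\<close> plays no role. Vector spaces are the modules over
  \<open>ring_of_type_algebra :: complex ring\<close>; when an algebra is used as a vector space,
  its product is ignored.
\<close>

locale complex_algebra = module "ring_of_type_algebra :: complex ring" A
  for A :: "(complex, 'a) module" (structure) +
  assumes prod_closed: "\<lbrakk>x \<in> carrier A; y \<in> carrier A\<rbrakk> \<Longrightarrow> x \<otimes> y \<in> carrier A"
    and prod_add_left: "\<lbrakk>x \<in> carrier A; y \<in> carrier A; z \<in> carrier A\<rbrakk>
          \<Longrightarrow> (x \<oplus> y) \<otimes> z = x \<otimes> z \<oplus> y \<otimes> z"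
    and prod_add_right: "\<lbrakk>x \<in> carrier A; y \<in> carrier A; z \<in> carrier A\<rbrakk>
          \<Longrightarrow> z \<otimes> (x \<oplus> y) = z \<otimes> x \<oplus> z \<otimes> y"
    and prod_smult_left: "\<lbrakk>x \<in> carrier A; y \<in> carrier A\<rbrakk>
          \<Longrightarrow> (c \<odot> x) \<otimes> y = c \<odot> (x \<otimes> y)"
    and prod_smult_right: "\<lbrakk>x \<in> carrier A; y \<in> carrier A\<rbrakk>
          \<Longrightarrow> x \<otimes> (c \<odot> y) = c \<odot> (x \<otimes> y)"
    and finite_dimensional: "\<exists>B. finite B \<and> B \<subseteq> carrier A \<and>
          (\<forall>x\<in>carrier A. \<exists>c. x = (\<Oplus>b\<in>B. c b \<odot> b))"

locale lie_algebra = complex_algebra L for L :: "(complex, 'a) module" (structure) +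
  assumes alternating: "x \<in> carrier L \<Longrightarrow> x \<otimes> x = \<zero>"
    and jacobi: "\<lbrakk>x \<in> carrier L; y \<in> carrier L; z \<in> carrier L\<rbrakk>
          \<Longrightarrow> x \<otimes> (y \<otimes> z) \<oplus> y \<otimes> (z \<otimes> x) \<oplus> z \<otimes> (x \<otimes> y) = \<zero>"

locale left_leibniz_algebra = complex_algebra M for M :: "(complex, 'a) module" (structure) +
  assumes left_leibniz: "\<lbrakk>a \<in> carrier M; b \<in> carrier M; c \<in> carrier M\<rbrakk>
          \<Longrightarrow> a \<otimes> (b \<otimes> c) = (a \<otimes> b) \<otimes> c \<oplus> b \<otimes> (a \<otimes> c)"

locale left_central_leibniz_algebra = left_leibniz_algebra M
  for M :: "(complex, 'a) module" (structure) +
  assumes left_central: "\<lbrakk>a \<in> carrier M; b \<in> carrier M\<rbrakk> \<Longrightarrow> a \<otimes> (b \<otimes> b) = \<zero>"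

definition leibniz_radical :: "(complex, 'a) module \<Rightarrow> 'a set" where
  "leibniz_radical M = {x \<in> carrier M. \<forall>a\<in>carrier M. x \<otimes>\<^bsub>M\<^esub> a \<oplus>\<^bsub>M\<^esub> a \<otimes>\<^bsub>M\<^esub> x = \<zero>\<^bsub>M\<^esub>}"

definition lie_center :: "(complex, 'a) module \<Rightarrow> 'a set" where
  "lie_center L = {z \<in> carrier L. \<forall>x\<in>carrier L. z \<otimes>\<^bsub>L\<^esub> x = \<zero>\<^bsub>L\<^esub>}"

definition abelian_algebra :: "(complex, 'a) module \<Rightarrow> bool" where
  "abelian_algebra L \<longleftrightarrow> (\<forall>x\<in>carrier L. \<forall>y\<in>carrier L. x \<otimes>\<^bsub>L\<^esub> y = \<zero>\<^bsub>L\<^esub>)"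

definition two_sided_ideal :: "'a set \<Rightarrow> (complex, 'a) module \<Rightarrow> bool" where
  "two_sided_ideal I A \<longleftrightarrow> submodule I (ring_of_type_algebra :: complex ring) A \<and>
     (\<forall>x\<in>carrier A. \<forall>a\<in>I. x \<otimes>\<^bsub>A\<^esub> a \<in> I \<and> a \<otimes>\<^bsub>A\<^esub> x \<in> I)"

text \<open>
  The map \<open>x + I \<mapsto> f x + I\<close>, which is well defined for additive \<open>f\<close> preserving \<open>I\<close>.
\<close>

definition induced :: "(complex, 'a) module \<Rightarrow> 'a set \<Rightarrow> ('a \<Rightarrow> 'a) \<Rightarrow> 'a set \<Rightarrow> 'a set" where
  "induced A I f U = (\<Union>u\<in>U. I +>\<^bsub>A\<^esub> f u)"

definition quotient_algebra :: "(complex, 'a) module \<Rightarrow> 'a set \<Rightarrow> (complex, 'a set) module" where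
  "quotient_algebra A I =
     ring.extend (A Quot I) (module.fields (\<lambda>c. induced A I (\<lambda>x. c \<odot>\<^bsub>A\<^esub> x)))"

definition linear_maps :: "(complex, 'a) module \<Rightarrow> (complex, 'b) module \<Rightarrow> ('a \<Rightarrow> 'b) set" where
  "linear_maps V W = {f \<in> carrier V \<rightarrow> carrier W.
     (\<forall>u\<in>carrier V. \<forall>v\<in>carrier V. f (u \<oplus>\<^bsub>V\<^esub> v) = f u \<oplus>\<^bsub>W\<^esub> f v) \<and>
     (\<forall>c. \<forall>v\<in>carrier V. f (c \<odot>\<^bsub>V\<^esub> v) = c \<odot>\<^bsub>W\<^esub> f v)}"

definition algebra_homs :: "(complex, 'a) module \<Rightarrow> (complex, 'b) module \<Rightarrow> ('a \<Rightarrow> 'b) set" where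
  "algebra_homs A B = {f \<in> linear_maps A B.
     \<forall>x\<in>carrier A. \<forall>y\<in>carrier A. f (x \<otimes>\<^bsub>A\<^esub> y) = f x \<otimes>\<^bsub>B\<^esub> f y}"

definition algebra_isos :: "(complex, 'a) module \<Rightarrow> (complex, 'b) module \<Rightarrow> ('a \<Rightarrow> 'b) set" where
  "algebra_isos A B = {f \<in> algebra_homs A B. bij_betw f (carrier A) (carrier B)}"

text \<open>
  Elements of Hom spaces are normalized to be \<open>undefined\<close> outside \<open>carrier V\<close>, so that
  equality in the Hom space is equality of linear maps on \<open>V\<close>. The Hom space is only a
  vector space; its \<open>mult\<close> and \<open>one\<close> are irrelevant.
\<close>

definition hom_space :: "(complex, 'a) module \<Rightarrow> (complex, 'b) module \<Rightarrow> (complex, 'a \<Rightarrow> 'b) module" where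
  "hom_space V W =
     \<lparr>carrier = linear_maps V W \<inter> extensional (carrier V),
      monoid.mult = undefined, one = undefined,
      zero = (\<lambda>v\<in>carrier V. \<zero>\<^bsub>W\<^esub>),
      add = (\<lambda>f g. \<lambda>v\<in>carrier V. f v \<oplus>\<^bsub>W\<^esub> g v),
      module.smult = (\<lambda>c f. \<lambda>v\<in>carrier V. c \<odot>\<^bsub>W\<^esub> f v)\<rparr>"

definition Der :: "(complex, 'a) module \<Rightarrow> (complex, 'a \<Rightarrow> 'a) module" where
  "Der L = (hom_space L L)
     \<lparr>carrier := {d \<in> carrier (hom_space L L). \<forall>x\<in>carrier L. \<forall>y\<in>carrier L.
        d (x \<otimes>\<^bsub>L\<^esub> y) = d x \<otimes>\<^bsub>L\<^esub> y \<oplus>\<^bsub>L\<^esub> x \<otimes>\<^bsub>L\<^esub> d y},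
      monoid.mult := (\<lambda>d e. \<lambda>x\<in>carrier L. d (e x) \<ominus>\<^bsub>L\<^esub> e (d x))\<rparr>"

definition common_Z :: "(complex, 'a) module \<Rightarrow> (complex, 'a) module \<Rightarrow> 'a set \<Rightarrow> 'a set" where
  "common_Z L1 L2 R = R \<inter> lie_center L1 \<inter> lie_center L2"

definition Hom_quot_Z :: "(complex, 'a) module \<Rightarrow> (complex, 'a) module \<Rightarrow> 'a set
    \<Rightarrow> (complex, 'a set \<Rightarrow> 'a) module" where
  "Hom_quot_Z L1 L2 R = hom_space (quotient_algebra L2 R) (L2\<lparr>carrier := common_Z L1 L2 R\<rparr>)"

text \<open>The action \<open>(x.f)(v) = - f (x.v)\<close> of \<open>x \<in> L\<^sub>1\<close> on \<open>f \<in> Hom (L\<^sub>2/R, Z)\<close>.\<close>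

definition hom_action :: "(complex, 'a) module \<Rightarrow> 'a set \<Rightarrow> ('a \<Rightarrow> 'a \<Rightarrow> 'a)
    \<Rightarrow> 'a \<Rightarrow> ('a set \<Rightarrow> 'a) \<Rightarrow> 'a set \<Rightarrow> 'a" where
  "hom_action L2 R \<alpha> x f =
     (\<lambda>v\<in>carrier (quotient_algebra L2 R). \<ominus>\<^bsub>L2\<^esub> f (induced L2 R (\<alpha> x) v))"

text \<open>
  \<open>L\<^sub>1\<close> and \<open>L\<^sub>2\<close> live on subsets of one type and literally share the subset \<open>R\<close>; apart from
  that their carriers and operations are unrelated.
\<close>

locale leibniz_data = L1: lie_algebra L1 + L2: lie_algebra L2
  for L1 :: "(complex, 'a) module" and L2 :: "(complex, 'a) module" +
  fixes R :: "'a set"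
    and \<alpha> :: "'a \<Rightarrow> 'a \<Rightarrow> 'a"
    and \<pi> :: "'a set \<Rightarrow> 'a set \<Rightarrow> 'a"
  assumes ideal_L1: "two_sided_ideal R L1"
    and ideal_L2: "two_sided_ideal R L2"
    and common_add: "\<lbrakk>a \<in> R; b \<in> R\<rbrakk> \<Longrightarrow> a \<oplus>\<^bsub>L1\<^esub> b = a \<oplus>\<^bsub>L2\<^esub> b"
    and common_smult: "a \<in> R \<Longrightarrow> c \<odot>\<^bsub>L1\<^esub> a = c \<odot>\<^bsub>L2\<^esub> a"
    and common_prod: "\<lbrakk>a \<in> R; b \<in> R\<rbrakk> \<Longrightarrow> a \<otimes>\<^bsub>L1\<^esub> b = a \<otimes>\<^bsub>L2\<^esub> b"
    and quotient_abelian: "abelian_algebra (quotient_algebra L2 R)"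
    and \<alpha>_hom: "\<alpha> \<in> algebra_homs L1 (Der L2)"
    and \<alpha>_left: "\<lbrakk>x \<in> R; y \<in> carrier L2\<rbrakk> \<Longrightarrow> \<alpha> x y = x \<otimes>\<^bsub>L2\<^esub> y"
    and \<alpha>_right: "\<lbrakk>x \<in> carrier L1; y \<in> R\<rbrakk> \<Longrightarrow> \<alpha> x y = x \<otimes>\<^bsub>L1\<^esub> y"
    and \<pi>_linear: "\<pi> \<in> linear_maps (quotient_algebra L1 R) (Hom_quot_Z L1 L2 R)"
    and \<pi>_equivariant: "\<lbrakk>x \<in> carrier L1; u \<in> carrier (quotient_algebra L1 R)\<rbrakk>
          \<Longrightarrow> \<pi> (induced L1 R (\<lambda>y. x \<otimes>\<^bsub>L1\<^esub> y) u) = hom_action L2 R \<alpha> x (\<pi> u)"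
    and \<pi>_inj: "inj_on \<pi> (carrier (quotient_algebra L1 R))"
    and \<pi>_nondegenerate: "\<lbrakk>v \<in> carrier (quotient_algebra L2 R);
          \<forall>f \<in> \<pi> ` carrier (quotient_algebra L1 R). f v = \<zero>\<^bsub>L2\<^esub>\<rbrakk>
          \<Longrightarrow> v = \<zero>\<^bsub>quotient_algebra L2 R\<^esub>"

definition psi' :: "(complex, 'a) module \<Rightarrow> (complex, 'a) module \<Rightarrow> 'a set
    \<Rightarrow> ('a set \<Rightarrow> 'a set \<Rightarrow> 'a) \<Rightarrow> 'a \<Rightarrow> 'a \<Rightarrow> 'a" where
  "psi' L1 L2 R \<pi> x y = \<pi> (R +>\<^bsub>L1\<^esub> x) (R +>\<^bsub>L2\<^esub> y)"

definition M_alg :: "(complex, 'a) module \<Rightarrow> (complex, 'a) module \<Rightarrow> 'a set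
    \<Rightarrow> ('a \<Rightarrow> 'a \<Rightarrow> 'a) \<Rightarrow> ('a set \<Rightarrow> 'a set \<Rightarrow> 'a) \<Rightarrow> (complex, 'a \<times> 'a) module" where
  "M_alg L1 L2 R \<alpha> \<pi> =
     \<lparr>carrier = carrier L1 \<times> carrier L2,
      monoid.mult = (\<lambda>(x\<^sub>1, y\<^sub>1) (x\<^sub>2, y\<^sub>2).
        (x\<^sub>1 \<otimes>\<^bsub>L1\<^esub> x\<^sub>2,
         (\<alpha> x\<^sub>1 y\<^sub>2 \<ominus>\<^bsub>L2\<^esub> \<alpha> x\<^sub>2 y\<^sub>1) \<oplus>\<^bsub>L2\<^esub> y\<^sub>1 \<otimes>\<^bsub>L2\<^esub> y\<^sub>2 \<oplus>\<^bsub>L2\<^esub> psi' L1 L2 R \<pi> x\<^sub>2 y\<^sub>1)),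
      one = undefined,
      zero = (\<zero>\<^bsub>L1\<^esub>, \<zero>\<^bsub>L2\<^esub>),
      add = (\<lambda>(x\<^sub>1, y\<^sub>1) (x\<^sub>2, y\<^sub>2). (x\<^sub>1 \<oplus>\<^bsub>L1\<^esub> x\<^sub>2, y\<^sub>1 \<oplus>\<^bsub>L2\<^esub> y\<^sub>2)),
      module.smult = (\<lambda>c (x, y). (c \<odot>\<^bsub>L1\<^esub> x, c \<odot>\<^bsub>L2\<^esub> y))\<rparr>"

definition D_ideal :: "(complex, 'a) module \<Rightarrow> 'a set \<Rightarrow> ('a \<times> 'a) set" where
  "D_ideal L2 R = {(a, \<ominus>\<^bsub>L2\<^esub> a) | a. a \<in> R}"

definition M_tilde :: "(complex, 'a) module \<Rightarrow> (complex, 'a) module \<Rightarrow> 'a set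
    \<Rightarrow> ('a \<Rightarrow> 'a \<Rightarrow> 'a) \<Rightarrow> ('a set \<Rightarrow> 'a set \<Rightarrow> 'a) \<Rightarrow> (complex, ('a \<times> 'a) set) module" where
  "M_tilde L1 L2 R \<alpha> \<pi> = quotient_algebra (M_alg L1 L2 R \<alpha> \<pi>) (D_ideal L2 R)"

end

theory Submission
  imports Defs
begin

text \<open>
  The Leibniz identity is trilinear, so on \<open>M = L\<^sub>1 \<oplus> L\<^sub>2\<close> it suffices to check it on triples of
  elements of the two summands. In these eight cases it reduces to the Jacobi identities, to
  \<open>\<alpha>\<close> being a morphism into derivations, and to the equivariance \<open>\<psi>'([xx'],y) = -\<psi>'(x',x.y)\<close>;
  all other occurrences of \<open>\<psi>'\<close> vanish because its values are central and it kills
  \<open>[L\<^sub>2L\<^sub>2] \<subseteq> R\<close>. The symmetrized product of \<open>(x,y)\<close> and \<open>(x',y')\<close> is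
  \<open>(0, \<psi>'(x',y) + \<psi>'(x,y'))\<close>. Left multiplications kill \<open>(0,z)\<close> for \<open>z \<in> Z\<close>, which gives
  left centrality; and as \<open>D\<close> meets \<open>0 \<oplus> L\<^sub>2\<close> trivially, the two nondegeneracy conditions on \<open>\<pi>\<close>
  say that the radical of the quotient is the image of \<open>R \<oplus> R\<close>.
\<close>

section \<open>Cancellation identities in abelian groups\<close>

lemma (in abelian_group) cancel_middle:
  assumes "x \<in> carrier G" "y \<in> carrier G"
  shows "x \<oplus> (y \<oplus> \<ominus> x) = y"
  using assms a_lcomm[of x y "\<ominus> x"] by (simp add: r_neg)

text \<open>This is the shape of the second component of a symmetrized product in \<open>M\<close>:
  \<open>p\<close> and \<open>q\<close> stand for the two \<alpha>-terms, \<open>r\<close> for the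
  bracket in \<open>L2\<close>, and \<open>u\<close>, \<open>v\<close> for the two values of \<psi>,
  which alone survive.\<close>

lemma (in abelian_group) cancel_opposite_terms:
  assumes "p \<in> carrier G" "q \<in> carrier G" "r \<in> carrier G" "u \<in> carrier G" "v \<in> carrier G"
  shows "(p \<oplus> \<ominus> q \<oplus> r \<oplus> u) \<oplus> (q \<oplus> \<ominus> p \<oplus> \<ominus> r \<oplus> v) = u \<oplus> v"
proof -
  have "(p \<oplus> \<ominus> q \<oplus> r \<oplus> u) \<oplus> (q \<oplus> \<ominus> p \<oplus> \<ominus> r \<oplus> v) =
      (p \<oplus> \<ominus> p) \<oplus> ((q \<oplus> \<ominus> q) \<oplus> ((r \<oplus> \<ominus> r) \<oplus> (u \<oplus> v)))"
    using assms by (simp add: a_ac)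
  then show ?thesis
    using assms by (simp add: r_neg)
qed

section \<open>Complex vector spaces and algebras\<close>

lemma scalar_simps [simp]:
  "carrier (ring_of_type_algebra :: complex ring) = UNIV"
  "x \<oplus>\<^bsub>ring_of_type_algebra\<^esub> y = x + (y::complex)"
  "x \<otimes>\<^bsub>ring_of_type_algebra\<^esub> y = x * (y::complex)"
  "\<zero>\<^bsub>ring_of_type_algebra\<^esub> = (0::complex)"
  "\<one>\<^bsub>ring_of_type_algebra\<^esub> = (1::complex)"
  by (simp_all add: ring_of_type_algebra_def)

text \<open>The vector space structure by itself: spans must be available for records whose product
  axioms and finite dimension are still to be shown, such as \<open>M\<close> and its
  quotient.\<close>

locale complex_space = module "ring_of_type_algebra :: complex ring" A
  for A :: "(complex, 'a) module" (structure)
begin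

lemma scale_closed [simp]: "x \<in> carrier A \<Longrightarrow> c \<odot> x \<in> carrier A"
  using smult_closed[of c x] by simp

lemma scale_add: "\<lbrakk>x \<in> carrier A; y \<in> carrier A\<rbrakk> \<Longrightarrow> c \<odot> (x \<oplus> y) = c \<odot> x \<oplus> c \<odot> y"
  using smult_r_distr[of c x y] by simp

lemma add_scale: "x \<in> carrier A \<Longrightarrow> (c + d) \<odot> x = c \<odot> x \<oplus> d \<odot> x"
  using smult_l_distr[of c d x] by simp

lemma scale_scale: "x \<in> carrier A \<Longrightarrow> (c * d) \<odot> x = c \<odot> (d \<odot> x)"
  using smult_assoc1[of c d x] by simp

lemma scale_one [simp]: "x \<in> carrier A \<Longrightarrow> 1 \<odot> x = x"
  using smult_one[of x] by simp

lemma scale_zero_left [simp]: "x \<in> carrier A \<Longrightarrow> 0 \<odot> x = \<zero>"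
  using smult_l_null[of x] by simp

lemma scale_zero_right [simp]: "c \<odot> \<zero> = \<zero>"
  using smult_r_null[of c] by simp

lemma scale_minus_right: "x \<in> carrier A \<Longrightarrow> c \<odot> (\<ominus> x) = \<ominus> (c \<odot> x)"
  using smult_r_minus[of c x] by simp

text \<open>With negation written as a scalar multiple, compatibility of a map with signs can be
  read off from its homogeneity.\<close>

lemma minus_eq_scale: "x \<in> carrier A \<Longrightarrow> \<ominus> x = (-1) \<odot> x"
  using M.minus_equality[of "(-1) \<odot> x" x] add_scale[of x "-1" 1] by simp

lemma minus_zero [simp]: "\<ominus> \<zero> = \<zero>"
  by (simp add: minus_eq_scale)

text \<open>The linear span when \<open>B\<close> is finite, the only case in which it is used; over
  an infinite set \<open>finsum\<close> is zero by convention.\<close>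

definition lin_span :: "'a set \<Rightarrow> 'a set" where
  "lin_span B = {x. \<exists>c. x = (\<Oplus>b\<in>B. c b \<odot> b)}"

lemma lin_span_zero:
  assumes "B \<subseteq> carrier A"
  shows "\<zero> \<in> lin_span B"
proof -
  have "(\<Oplus>b\<in>B. 0 \<odot> b) = (\<Oplus>b\<in>B. \<zero>)"
    using assms by (intro M.finsum_cong') auto
  then show ?thesis
    unfolding lin_span_def by (auto intro!: exI[of _ "\<lambda>_. 0"])
qed

lemma lin_span_add:
  assumes "B \<subseteq> carrier A" "x \<in> lin_span B" "y \<in> lin_span B"
  shows "x \<oplus> y \<in> lin_span B"
proof -
  obtain c d where x: "x = (\<Oplus>b\<in>B. c b \<odot> b)" and y: "y = (\<Oplus>b\<in>B. d b \<odot> b)"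
    using assms by (auto simp: lin_span_def)
  have "x \<oplus> y = (\<Oplus>b\<in>B. c b \<odot> b \<oplus> d b \<odot> b)"
    unfolding x y using assms by (intro M.finsum_addf[symmetric]) auto
  also have "\<dots> = (\<Oplus>b\<in>B. (c b + d b) \<odot> b)"
    using assms by (intro M.finsum_cong') (auto simp: add_scale subset_eq)
  finally show ?thesis
    unfolding lin_span_def by auto
qed

lemma lin_span_base:
  assumes "finite B" "B \<subseteq> carrier A" "b \<in> B"
  shows "a \<odot> b \<in> lin_span B"
proof -
  have "(\<Oplus>b'\<in>B. (if b = b' then a else 0) \<odot> b') = (\<Oplus>b'\<in>B. if b = b' then a \<odot> b' else \<zero>)"
    using assms by (intro M.finsum_cong') auto
  also have "\<dots> = a \<odot> b"
    using assms by (intro M.finsum_singleton) auto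
  finally show ?thesis
    unfolding lin_span_def by (auto intro!: exI[of _ "\<lambda>b'. if b = b' then a else 0"])
qed

end

text \<open>The summands are added one at a time by induction, which avoids reindexing the sum along
  an \<open>f\<close> that may identify elements of \<open>S\<close>. The set \<open>T\<close> may
  exceed the image of \<open>S\<close>, so that the inclusions of both summands of a direct sum can
  be treated with one common \<open>T\<close>.\<close>

lemma (in complex_space) linear_image_in_span:
  assumes "complex_space W" and f: "f \<in> linear_maps A W"
    and S: "finite S" "S \<subseteq> carrier A"
    and T: "finite T" "T \<subseteq> carrier W" "f ` S \<subseteq> T"
    and x: "x \<in> lin_span S"
  shows "f x \<in> complex_space.lin_span W T"
proof -
  interpret W: complex_space W by fact
  obtain c where x: "x = (\<Oplus>b\<in>S. c b \<odot> b)"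
    using x by (auto simp: lin_span_def)
  have add: "f (u \<oplus> v) = f u \<oplus>\<^bsub>W\<^esub> f v" if "u \<in> carrier A" "v \<in> carrier A" for u v
    using f that by (auto simp: linear_maps_def)
  have scale: "f (a \<odot> u) = a \<odot>\<^bsub>W\<^esub> f u" if "u \<in> carrier A" for a u
    using f that by (auto simp: linear_maps_def)
  have cl: "f u \<in> carrier W" if "u \<in> carrier A" for u
    using f that by (auto simp: linear_maps_def)
  have "f (\<Oplus>b\<in>F. c b \<odot> b) \<in> W.lin_span T" if "finite F" "F \<subseteq> S" for F
    using that
  proof (induction F rule: finite_induct)
    case empty
    have "f \<zero> = \<zero>\<^bsub>W\<^esub>"
      using scale[of \<zero> 0] cl[of \<zero>] by simp
    then show ?case
      using W.lin_span_zero T by simp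
  next
    case (insert b F)
    have "(\<Oplus>b\<in>insert b F. c b \<odot> b) = c b \<odot> b \<oplus> (\<Oplus>b\<in>F. c b \<odot> b)"
      using insert S by (intro M.finsum_insert) auto
    moreover have "(\<Oplus>b\<in>F. c b \<odot> b) \<in> carrier A"
      using insert S by (intro M.finsum_closed) auto
    ultimately have "f (\<Oplus>b\<in>insert b F. c b \<odot> b) = c b \<odot>\<^bsub>W\<^esub> f b \<oplus>\<^bsub>W\<^esub> f (\<Oplus>b\<in>F. c b \<odot> b)"
      using insert S by (auto simp: add scale subset_eq)
    then show ?case
      using insert T by (auto intro!: W.lin_span_add W.lin_span_base)
  qed
  then show ?thesis
    using S x by auto
qed

sublocale complex_algebra \<subseteq> complex_space ..

context complex_algebra
begin

declare prod_closed [simp]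

lemma prod_zero_left [simp]: "x \<in> carrier A \<Longrightarrow> \<zero> \<otimes> x = \<zero>"
  using prod_smult_left[of \<zero> x 0] by simp

lemma prod_zero_right [simp]: "x \<in> carrier A \<Longrightarrow> x \<otimes> \<zero> = \<zero>"
  using prod_smult_right[of x \<zero> 0] by simp

lemma prod_minus_left: "\<lbrakk>x \<in> carrier A; y \<in> carrier A\<rbrakk> \<Longrightarrow> (\<ominus> x) \<otimes> y = \<ominus> (x \<otimes> y)"
  by (simp add: minus_eq_scale prod_smult_left)

lemma prod_minus_right: "\<lbrakk>x \<in> carrier A; y \<in> carrier A\<rbrakk> \<Longrightarrow> x \<otimes> (\<ominus> y) = \<ominus> (x \<otimes> y)"
  by (simp add: minus_eq_scale prod_smult_right)

lemma finite_spanning_set: "\<exists>B. finite B \<and> B \<subseteq> carrier A \<and> carrier A \<subseteq> lin_span B"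
  using finite_dimensional by (auto simp: lin_span_def)

end

text \<open>Each axiom is a closure condition or an equation and is transported from preimages; the
  image of a finite spanning set spans. \<open>B\<close> enters as a bare record, so the result
  produces the algebra structure of a quotient from its coset formulas.\<close>

lemma complex_algebra_hom_image:
  assumes "complex_algebra A"
    and onto: "f ` carrier A = carrier B"
    and zero: "f \<zero>\<^bsub>A\<^esub> = \<zero>\<^bsub>B\<^esub>"
    and add: "\<And>x y. \<lbrakk>x \<in> carrier A; y \<in> carrier A\<rbrakk> \<Longrightarrow> f (x \<oplus>\<^bsub>A\<^esub> y) = f x \<oplus>\<^bsub>B\<^esub> f y"
    and prod: "\<And>x y. \<lbrakk>x \<in> carrier A; y \<in> carrier A\<rbrakk> \<Longrightarrow> f (x \<otimes>\<^bsub>A\<^esub> y) = f x \<otimes>\<^bsub>B\<^esub> f y"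
    and scale: "\<And>c x. x \<in> carrier A \<Longrightarrow> f (c \<odot>\<^bsub>A\<^esub> x) = c \<odot>\<^bsub>B\<^esub> f x"
  shows "complex_algebra B"
proof -
  interpret A: complex_algebra A by fact
  have cl: "f x \<in> carrier B" if "x \<in> carrier A" for x
    using onto that by auto
  have pre: "\<exists>x\<in>carrier A. u = f x" if "u \<in> carrier B" for u
    using onto that by auto
  interpret B: abelian_group B
  proof (rule abelian_groupI)
    fix u v assume "u \<in> carrier B" "v \<in> carrier B"
    then obtain x y where "x \<in> carrier A" "u = f x" "y \<in> carrier A" "v = f y"
      using pre by metis
    then show "u \<oplus>\<^bsub>B\<^esub> v \<in> carrier B" "u \<oplus>\<^bsub>B\<^esub> v = v \<oplus>\<^bsub>B\<^esub> u"
      using cl by (simp_all add: add[symmetric] A.M.a_comm)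
    fix w assume "w \<in> carrier B"
    then obtain z where "z \<in> carrier A" "w = f z"
      using pre by metis
    then show "u \<oplus>\<^bsub>B\<^esub> v \<oplus>\<^bsub>B\<^esub> w = u \<oplus>\<^bsub>B\<^esub> (v \<oplus>\<^bsub>B\<^esub> w)"
      using \<open>x \<in> carrier A\<close> \<open>u = f x\<close> \<open>y \<in> carrier A\<close> \<open>v = f y\<close>
      by (simp add: add[symmetric] A.M.a_assoc)
  next
    show "\<zero>\<^bsub>B\<^esub> \<in> carrier B"
      using cl[of "\<zero>\<^bsub>A\<^esub>"] zero by simp
  next
    fix u assume "u \<in> carrier B"
    then obtain x where x: "x \<in> carrier A" "u = f x"
      using pre by metis
    then show "\<zero>\<^bsub>B\<^esub> \<oplus>\<^bsub>B\<^esub> u = u"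
      by (simp add: zero[symmetric] add[symmetric])
    show "\<exists>v\<in>carrier B. v \<oplus>\<^bsub>B\<^esub> u = \<zero>\<^bsub>B\<^esub>"
      using x cl by (intro bexI[of _ "f (\<ominus>\<^bsub>A\<^esub> x)"])
        (simp_all add: zero[symmetric] add[symmetric] A.M.l_neg)
  qed
  interpret B: module "ring_of_type_algebra :: complex ring" B
  proof (rule moduleI)
    show "cring (ring_of_type_algebra :: complex ring)" ..
    show "abelian_group B" by (rule B.abelian_group_axioms)
    fix u assume "u \<in> carrier B"
    then obtain x where x: "x \<in> carrier A" "u = f x"
      using pre by metis
    show "a \<odot>\<^bsub>B\<^esub> u \<in> carrier B" for a
      using x cl by (simp add: scale[symmetric])
    show "(a \<oplus>\<^bsub>ring_of_type_algebra\<^esub> b) \<odot>\<^bsub>B\<^esub> u = a \<odot>\<^bsub>B\<^esub> u \<oplus>\<^bsub>B\<^esub> b \<odot>\<^bsub>B\<^esub> u" for a b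
      using x by (simp add: scale[symmetric] add[symmetric] A.add_scale)
    show "(a \<otimes>\<^bsub>ring_of_type_algebra\<^esub> b) \<odot>\<^bsub>B\<^esub> u = a \<odot>\<^bsub>B\<^esub> (b \<odot>\<^bsub>B\<^esub> u)" for a b
      using x by (simp add: scale[symmetric] A.scale_scale)
    show "\<one>\<^bsub>ring_of_type_algebra\<^esub> \<odot>\<^bsub>B\<^esub> u = u"
      using x by (simp add: scale[symmetric])
    fix v assume "v \<in> carrier B"
    then obtain y where "y \<in> carrier A" "v = f y"
      using pre by metis
    then show "a \<odot>\<^bsub>B\<^esub> (u \<oplus>\<^bsub>B\<^esub> v) = a \<odot>\<^bsub>B\<^esub> u \<oplus>\<^bsub>B\<^esub> a \<odot>\<^bsub>B\<^esub> v" for a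
      using x by (simp add: scale[symmetric] add[symmetric] A.scale_add)
  qed
  interpret B: complex_space B ..
  have lin: "f \<in> linear_maps A B"
    using cl add scale by (auto simp: linear_maps_def)
  obtain S where S: "finite S" "S \<subseteq> carrier A" "carrier A \<subseteq> A.lin_span S"
    using A.finite_spanning_set by blast
  have fS: "f ` S \<subseteq> carrier B"
    using S cl by auto
  have "f x \<in> B.lin_span (f ` S)" if "x \<in> carrier A" for x
    using S fS that lin by (intro A.linear_image_in_span[OF B.complex_space_axioms]) auto
  then have span: "carrier B \<subseteq> B.lin_span (f ` S)"
    unfolding onto[symmetric] by blast
  show ?thesis
  proof (unfold_locales)
    fix u v assume "u \<in> carrier B" "v \<in> carrier B"
    then obtain x y where xy: "x \<in> carrier A" "u = f x" "y \<in> carrier A" "v = f y"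
      using pre by metis
    then show "u \<otimes>\<^bsub>B\<^esub> v \<in> carrier B"
      using cl by (simp add: prod[symmetric])
    show "(c \<odot>\<^bsub>B\<^esub> u) \<otimes>\<^bsub>B\<^esub> v = c \<odot>\<^bsub>B\<^esub> (u \<otimes>\<^bsub>B\<^esub> v)"
      "u \<otimes>\<^bsub>B\<^esub> (c \<odot>\<^bsub>B\<^esub> v) = c \<odot>\<^bsub>B\<^esub> (u \<otimes>\<^bsub>B\<^esub> v)" for c
      using xy by (simp_all add: prod[symmetric] scale[symmetric]
          A.prod_smult_left A.prod_smult_right)
    fix w assume "w \<in> carrier B"
    then obtain z where "z \<in> carrier A" "w = f z"
      using pre by metis
    then show "(u \<oplus>\<^bsub>B\<^esub> v) \<otimes>\<^bsub>B\<^esub> w = u \<otimes>\<^bsub>B\<^esub> w \<oplus>\<^bsub>B\<^esub> v \<otimes>\<^bsub>B\<^esub> w"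
      "w \<otimes>\<^bsub>B\<^esub> (u \<oplus>\<^bsub>B\<^esub> v) = w \<otimes>\<^bsub>B\<^esub> u \<oplus>\<^bsub>B\<^esub> w \<otimes>\<^bsub>B\<^esub> v"
      using xy by (simp_all add: prod[symmetric] add[symmetric] A.prod_add_left A.prod_add_right)
  next
    show "\<exists>S. finite S \<and> S \<subseteq> carrier B \<and> (\<forall>u\<in>carrier B. \<exists>c. u = (\<Oplus>\<^bsub>B\<^esub>b\<in>S. c b \<odot>\<^bsub>B\<^esub> b))"
      using S fS span by (intro exI[of _ "f ` S"]) (auto simp: B.lin_span_def)
  qed
qed

text \<open>Both axioms are equations in sums, products and zero, and such equations pass to
  surjective images.\<close>

lemma left_central_leibniz_algebra_hom_image:
  assumes "left_central_leibniz_algebra A" and "complex_algebra B"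
    and onto: "f ` carrier A = carrier B"
    and zero: "f \<zero>\<^bsub>A\<^esub> = \<zero>\<^bsub>B\<^esub>"
    and add: "\<And>x y. \<lbrakk>x \<in> carrier A; y \<in> carrier A\<rbrakk> \<Longrightarrow> f (x \<oplus>\<^bsub>A\<^esub> y) = f x \<oplus>\<^bsub>B\<^esub> f y"
    and prod: "\<And>x y. \<lbrakk>x \<in> carrier A; y \<in> carrier A\<rbrakk> \<Longrightarrow> f (x \<otimes>\<^bsub>A\<^esub> y) = f x \<otimes>\<^bsub>B\<^esub> f y"
  shows "left_central_leibniz_algebra B"
proof -
  interpret A: left_central_leibniz_algebra A by fact
  interpret B: complex_algebra B by fact
  have pre: "\<exists>x\<in>carrier A. u = f x" if "u \<in> carrier B" for u
    using onto that by auto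
  show ?thesis
  proof (unfold_locales)
    fix u v assume "u \<in> carrier B" "v \<in> carrier B"
    then obtain x y where xy: "x \<in> carrier A" "u = f x" "y \<in> carrier A" "v = f y"
      using pre by metis
    then show "u \<otimes>\<^bsub>B\<^esub> (v \<otimes>\<^bsub>B\<^esub> v) = \<zero>\<^bsub>B\<^esub>"
      by (simp add: prod[symmetric] zero[symmetric] A.left_central)
    fix w assume "w \<in> carrier B"
    then obtain z where "z \<in> carrier A" "w = f z"
      using pre by metis
    then show "u \<otimes>\<^bsub>B\<^esub> (v \<otimes>\<^bsub>B\<^esub> w) = (u \<otimes>\<^bsub>B\<^esub> v) \<otimes>\<^bsub>B\<^esub> w \<oplus>\<^bsub>B\<^esub> v \<otimes>\<^bsub>B\<^esub> (u \<otimes>\<^bsub>B\<^esub> w)"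
      using xy A.left_leibniz[of x y z] by (simp add: prod[symmetric] add[symmetric])
  qed
qed

section \<open>Quotient algebras\<close>

locale algebra_ideal = complex_algebra A for A :: "(complex, 'a) module" (structure) +
  fixes I :: "'a set"
  assumes ideal: "two_sided_ideal I A"

sublocale algebra_ideal \<subseteq> I: abelian_subgroup I A
proof (rule abelian_subgroupI3)
  show "additive_subgroup I A"
    using ideal by (auto simp: two_sided_ideal_def submodule_def additive_subgroup_def)
qed (rule M.abelian_group_axioms)

context algebra_ideal
begin

lemma ideal_subset: "I \<subseteq> carrier A"
  by (rule I.a_subset)

lemma ideal_prod_right: "\<lbrakk>x \<in> carrier A; a \<in> I\<rbrakk> \<Longrightarrow> x \<otimes> a \<in> I"
  and ideal_prod_left: "\<lbrakk>x \<in> carrier A; a \<in> I\<rbrakk> \<Longrightarrow> a \<otimes> x \<in> I"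
  using ideal by (auto simp: two_sided_ideal_def)

lemma ideal_scale: "a \<in> I \<Longrightarrow> c \<odot> a \<in> I"
  using ideal submodule.smult_closed[of I ring_of_type_algebra A c a]
  by (auto simp: two_sided_ideal_def)

lemma coset_eq_iff:
  assumes "x \<in> carrier A" "y \<in> carrier A"
  shows "I +> x = I +> y \<longleftrightarrow> x \<ominus> y \<in> I"
proof
  assume "I +> x = I +> y"
  then show "x \<ominus> y \<in> I"
    using assms I.a_repr_independenceD[of x y] I.a_rcos_module[of y x] by (simp add: a_minus_def)
next
  assume "x \<ominus> y \<in> I"
  then show "I +> x = I +> y"
    using assms I.a_repr_independence'[of x y] I.a_rcos_module[of y x] by (simp add: a_minus_def)
qed

lemma coset_absorb:
  assumes "i \<in> I" "x \<in> carrier A"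
  shows "I +> (i \<oplus> x) = I +> x"
  using assms M.a_rcosI[of i I x] ideal_subset I.a_repr_independence'[of "i \<oplus> x" x] by auto

lemma mem_cosetE:
  assumes "u \<in> I +> x"
  obtains i where "i \<in> I" "u = i \<oplus> x"
  using assms by (auto simp: a_r_coset_def')

lemma mem_coset_self: "x \<in> carrier A \<Longrightarrow> x \<in> I +> x"
  using M.a_rcosI[of \<zero> I x] ideal_subset by auto

lemma coset_eq_ideal_iff: "x \<in> carrier A \<Longrightarrow> I +> x = I \<longleftrightarrow> x \<in> I"
  using mem_coset_self[of x] I.a_rcos_const[of x] by auto

text \<open>\<open>induced\<close> is a union over all representatives. Additivity of
  \<open>f\<close> and invariance of \<open>I\<close> give each representative the same image coset,
  so the union collapses to a single coset.\<close>

lemma induced_coset: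
  assumes f: "\<And>x. x \<in> carrier A \<Longrightarrow> f x \<in> carrier A"
    and add: "\<And>x y. \<lbrakk>x \<in> carrier A; y \<in> carrier A\<rbrakk> \<Longrightarrow> f (x \<oplus> y) = f x \<oplus> f y"
    and inv: "\<And>i. i \<in> I \<Longrightarrow> f i \<in> I"
    and x: "x \<in> carrier A"
  shows "induced A I f (I +> x) = I +> f x"
proof -
  have "I +> f u = I +> f x" if u: "u \<in> I +> x" for u
  proof -
    obtain i where "i \<in> I" "u = i \<oplus> x"
      using u by (rule mem_cosetE)
    then show ?thesis
      using x ideal_subset by (simp add: add coset_absorb inv f subset_eq)
  qed
  then show ?thesis
    unfolding induced_def using mem_coset_self[OF x] by blast
qed

lemma carrier_quotient: "carrier (quotient_algebra A I) = (+>) I ` carrier A"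
  by (auto simp: quotient_algebra_def FactRing_def ring.defs module.defs A_RCOSETS_def')

lemma zero_quotient: "\<zero>\<^bsub>quotient_algebra A I\<^esub> = I"
  by (simp add: quotient_algebra_def FactRing_def ring.defs module.defs)

lemma add_quotient:
  "\<lbrakk>x \<in> carrier A; y \<in> carrier A\<rbrakk>
    \<Longrightarrow> (I +> x) \<oplus>\<^bsub>quotient_algebra A I\<^esub> (I +> y) = I +> (x \<oplus> y)"
  by (simp add: quotient_algebra_def FactRing_def ring.defs module.defs I.a_rcos_sum)

lemma scale_quotient:
  "x \<in> carrier A \<Longrightarrow> c \<odot>\<^bsub>quotient_algebra A I\<^esub> (I +> x) = I +> (c \<odot> x)"
  by (simp add: quotient_algebra_def FactRing_def ring.defs module.defs induced_coset
      scale_add ideal_scale)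

text \<open>The product of the factor ring, \<open>rcoset_mult\<close>, is a union over pairs of
  representatives; as \<open>I\<close> is a two-sided ideal, all members of this union are
  equal.\<close>

lemma prod_quotient:
  assumes x: "x \<in> carrier A" and y: "y \<in> carrier A"
  shows "(I +> x) \<otimes>\<^bsub>quotient_algebra A I\<^esub> (I +> y) = I +> (x \<otimes> y)"
proof -
  have "I +> (u \<otimes> v) = I +> (x \<otimes> y)" if uv: "u \<in> I +> x" "v \<in> I +> y" for u v
  proof -
    obtain i j where ij: "i \<in> I" "u = i \<oplus> x" "j \<in> I" "v = j \<oplus> y"
      using uv by (metis mem_cosetE)
    then have c: "i \<in> carrier A" "j \<in> carrier A"
      using ideal_subset by auto
    \<comment> \<open>The first two of the three summands lie in \<open>I\<close> and are absorbed
      by the coset.\<close>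
    have "u \<otimes> v = i \<otimes> v \<oplus> (x \<otimes> j \<oplus> x \<otimes> y)"
      using ij c x y prod_add_left[of i x v] by (simp add: prod_add_right[of j y x])
    then show ?thesis
      using ij c x y by (simp add: coset_absorb ideal_prod_left ideal_prod_right)
  qed
  then have "rcoset_mult A I (I +> x) (I +> y) = I +> (x \<otimes> y)"
    unfolding rcoset_mult_def using mem_coset_self[OF x] mem_coset_self[OF y] by blast
  then show ?thesis
    by (simp add: quotient_algebra_def FactRing_def ring.defs module.defs)
qed

lemma coset_zero: "I +> \<zero> = I"
  by (simp add: ideal_subset)

lemma quotient_complex_algebra: "complex_algebra (quotient_algebra A I)"
  by (rule complex_algebra_hom_image[OF complex_algebra_axioms, of "(+>) I"])
    (simp_all add: carrier_quotient zero_quotient coset_zero add_quotient prod_quotient scale_quotient)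

lemma quotient_left_central_leibniz:
  assumes "left_central_leibniz_algebra A"
  shows "left_central_leibniz_algebra (quotient_algebra A I)"
  by (rule left_central_leibniz_algebra_hom_image[OF assms quotient_complex_algebra, of "(+>) I"])
    (simp_all add: carrier_quotient zero_quotient coset_zero add_quotient prod_quotient)

end

section \<open>Bilinearity and equivariance of the structure maps\<close>

context lie_algebra
begin

text \<open>Polarization: expand the square of \<open>x \<oplus> y\<close>, which is zero.\<close>

lemma skew: assumes "x \<in> carrier L" "y \<in> carrier L" shows "x \<otimes> y = \<ominus> (y \<otimes> x)"
proof -
  have "\<zero> = (x \<oplus> y) \<otimes> (x \<oplus> y)"
    using assms by (simp add: alternating)
  also have "\<dots> = x \<otimes> y \<oplus> y \<otimes> x"
    using assms prod_add_left[of x y "x \<oplus> y"]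
    by (simp add: prod_add_right[of x y x] prod_add_right[of x y y] alternating)
  finally show ?thesis
    using assms by (intro M.minus_equality[symmetric]) auto
qed

text \<open>The Jacobi identity solved for its first term; skew symmetry then brings the other two
  terms into the required order. Thus a Lie algebra is a left Leibniz algebra.\<close>

lemma leibniz:
  assumes "x \<in> carrier L" "y \<in> carrier L" "z \<in> carrier L"
  shows "x \<otimes> (y \<otimes> z) = (x \<otimes> y) \<otimes> z \<oplus> y \<otimes> (x \<otimes> z)"
proof -
  have "(x \<otimes> y) \<otimes> z = \<ominus> (z \<otimes> (x \<otimes> y))" "y \<otimes> (x \<otimes> z) = \<ominus> (y \<otimes> (z \<otimes> x))"
    using assms skew[of "x \<otimes> y" z] skew[of x z] by (simp_all add: prod_minus_right)
  moreover have "x \<otimes> (y \<otimes> z) \<oplus> (y \<otimes> (z \<otimes> x) \<oplus> z \<otimes> (x \<otimes> y)) = \<zero>"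
    using jacobi[OF assms] assms by (simp add: M.a_assoc)
  then have "x \<otimes> (y \<otimes> z) = \<ominus> (y \<otimes> (z \<otimes> x) \<oplus> z \<otimes> (x \<otimes> y))"
    using assms by (intro M.minus_equality[symmetric]) auto
  ultimately show ?thesis
    using assms by (simp add: M.minus_add M.a_comm)
qed

end

section \<open>The structure maps \<alpha> and \<psi> on representatives\<close>

context leibniz_data
begin

sublocale I1: algebra_ideal L1 R
  by unfold_locales (rule ideal_L1)

sublocale I2: algebra_ideal L2 R
  by unfold_locales (rule ideal_L2)

abbreviation "\<psi> \<equiv> psi' L1 L2 R \<pi>"

lemma R_L1 [simp]: "a \<in> R \<Longrightarrow> a \<in> carrier L1"
  using I1.ideal_subset by auto

lemma R_L2 [simp]: "a \<in> R \<Longrightarrow> a \<in> carrier L2"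
  using I2.ideal_subset by auto

text \<open>The two algebras are assumed to share sums, scalar multiples and products on
  \<open>R\<close>. That their zeros agree follows by computing the multiple by 0 of an element of
  \<open>R\<close> in both.\<close>

lemma common_zero: "\<zero>\<^bsub>L1\<^esub> = \<zero>\<^bsub>L2\<^esub>"
  using common_smult[of "\<zero>\<^bsub>L1\<^esub>" 0] by simp

lemma common_minus: "a \<in> R \<Longrightarrow> \<ominus>\<^bsub>L1\<^esub> a = \<ominus>\<^bsub>L2\<^esub> a"
  by (simp add: L1.minus_eq_scale L2.minus_eq_scale common_smult)

lemma \<alpha>_mem: "x \<in> carrier L1 \<Longrightarrow> \<alpha> x \<in> carrier (Der L2)"
  using \<alpha>_hom by (simp add: algebra_homs_def linear_maps_def Pi_def)

lemma \<alpha>_closed [simp]: "\<lbrakk>x \<in> carrier L1; y \<in> carrier L2\<rbrakk> \<Longrightarrow> \<alpha> x y \<in> carrier L2"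
  using \<alpha>_mem[of x] by (simp add: linear_maps_def Der_def hom_space_def Pi_def)

lemma \<alpha>_add_right: "\<lbrakk>x \<in> carrier L1; y \<in> carrier L2; z \<in> carrier L2\<rbrakk>
    \<Longrightarrow> \<alpha> x (y \<oplus>\<^bsub>L2\<^esub> z) = \<alpha> x y \<oplus>\<^bsub>L2\<^esub> \<alpha> x z"
  using \<alpha>_mem[of x] by (simp add: linear_maps_def Der_def hom_space_def)

lemma \<alpha>_scale_right: "\<lbrakk>x \<in> carrier L1; y \<in> carrier L2\<rbrakk>
    \<Longrightarrow> \<alpha> x (c \<odot>\<^bsub>L2\<^esub> y) = c \<odot>\<^bsub>L2\<^esub> \<alpha> x y"
  using \<alpha>_mem[of x] by (simp add: linear_maps_def Der_def hom_space_def)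

lemma \<alpha>_derivation: "\<lbrakk>x \<in> carrier L1; y \<in> carrier L2; z \<in> carrier L2\<rbrakk>
    \<Longrightarrow> \<alpha> x (y \<otimes>\<^bsub>L2\<^esub> z) = \<alpha> x y \<otimes>\<^bsub>L2\<^esub> z \<oplus>\<^bsub>L2\<^esub> y \<otimes>\<^bsub>L2\<^esub> \<alpha> x z"
  using \<alpha>_mem[of x] by (simp add: linear_maps_def Der_def hom_space_def)

lemma \<alpha>_add_left:
  assumes "x \<in> carrier L1" "x' \<in> carrier L1" "y \<in> carrier L2"
  shows "\<alpha> (x \<oplus>\<^bsub>L1\<^esub> x') y = \<alpha> x y \<oplus>\<^bsub>L2\<^esub> \<alpha> x' y"
proof -
  have "\<alpha> (x \<oplus>\<^bsub>L1\<^esub> x') = \<alpha> x \<oplus>\<^bsub>Der L2\<^esub> \<alpha> x'"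
    using \<alpha>_hom assms by (simp add: algebra_homs_def linear_maps_def)
  then show ?thesis
    using assms by (simp add: Der_def hom_space_def)
qed

lemma \<alpha>_scale_left:
  assumes "x \<in> carrier L1" "y \<in> carrier L2"
  shows "\<alpha> (c \<odot>\<^bsub>L1\<^esub> x) y = c \<odot>\<^bsub>L2\<^esub> \<alpha> x y"
proof -
  have "\<alpha> (c \<odot>\<^bsub>L1\<^esub> x) = c \<odot>\<^bsub>Der L2\<^esub> \<alpha> x"
    using \<alpha>_hom assms by (simp add: algebra_homs_def linear_maps_def)
  then show ?thesis
    using assms by (simp add: Der_def hom_space_def)
qed

lemma \<alpha>_bracket:
  assumes "x \<in> carrier L1" "x' \<in> carrier L1" "y \<in> carrier L2"
  shows "\<alpha> (x \<otimes>\<^bsub>L1\<^esub> x') y = \<alpha> x (\<alpha> x' y) \<ominus>\<^bsub>L2\<^esub> \<alpha> x' (\<alpha> x y)"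
proof -
  have "\<alpha> (x \<otimes>\<^bsub>L1\<^esub> x') = \<alpha> x \<otimes>\<^bsub>Der L2\<^esub> \<alpha> x'"
    using \<alpha>_hom assms by (simp add: algebra_homs_def)
  then show ?thesis
    using assms by (simp add: Der_def hom_space_def)
qed

lemma \<alpha>_zero_right [simp]: "x \<in> carrier L1 \<Longrightarrow> \<alpha> x \<zero>\<^bsub>L2\<^esub> = \<zero>\<^bsub>L2\<^esub>"
  using \<alpha>_scale_right[of x "\<zero>\<^bsub>L2\<^esub>" 0] by simp

lemma \<alpha>_zero_left [simp]: "y \<in> carrier L2 \<Longrightarrow> \<alpha> \<zero>\<^bsub>L1\<^esub> y = \<zero>\<^bsub>L2\<^esub>"
  using \<alpha>_scale_left[of "\<zero>\<^bsub>L1\<^esub>" y 0] by simp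

lemma \<alpha>_minus_right: "\<lbrakk>x \<in> carrier L1; y \<in> carrier L2\<rbrakk> \<Longrightarrow> \<alpha> x (\<ominus>\<^bsub>L2\<^esub> y) = \<ominus>\<^bsub>L2\<^esub> \<alpha> x y"
  by (simp add: L2.minus_eq_scale \<alpha>_scale_right)

text \<open>On \<open>R\<close> the action is the bracket of \<open>L1\<close>, in which
  \<open>R\<close> is an ideal. This makes the induced action of \<open>L1\<close> on
  \<open>L2/R\<close> computable on representatives.\<close>

lemma \<alpha>_preserves_R: "\<lbrakk>x \<in> carrier L1; a \<in> R\<rbrakk> \<Longrightarrow> \<alpha> x a \<in> R"
  by (simp add: \<alpha>_right I1.ideal_prod_right)

lemma \<pi>_mem: "x \<in> carrier L1 \<Longrightarrow> \<pi> (R +>\<^bsub>L1\<^esub> x) \<in> carrier (Hom_quot_Z L1 L2 R)"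
  using \<pi>_linear by (auto simp: linear_maps_def I1.carrier_quotient)

lemma \<psi>_mem:
  assumes "x \<in> carrier L1" "y \<in> carrier L2"
  shows "\<psi> x y \<in> common_Z L1 L2 R"
  using \<pi>_mem[OF assms(1)] assms(2)
  by (auto simp: psi'_def Hom_quot_Z_def hom_space_def linear_maps_def I2.carrier_quotient)

lemma \<psi>_R [simp]: "\<lbrakk>x \<in> carrier L1; y \<in> carrier L2\<rbrakk> \<Longrightarrow> \<psi> x y \<in> R"
  using \<psi>_mem by (auto simp: common_Z_def)

text \<open>The values of \<psi> are central in \<open>L1\<close>. \<open>lie_center\<close> records
  the product on one side; skew symmetry gives the other. The result is written with the zero of
  \<open>L2\<close> because it is used for \<alpha>, whose values lie there.\<close>

lemma \<psi>_prod_L1: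
  assumes "x \<in> carrier L1" "y \<in> carrier L2" "x' \<in> carrier L1"
  shows "\<psi> x y \<otimes>\<^bsub>L1\<^esub> x' = \<zero>\<^bsub>L2\<^esub>" "x' \<otimes>\<^bsub>L1\<^esub> \<psi> x y = \<zero>\<^bsub>L2\<^esub>"
  using assms \<psi>_mem[of x y] L1.skew[of x' "\<psi> x y"]
  by (auto simp: common_Z_def lie_center_def common_zero[symmetric])

lemma \<psi>_prod_L2:
  assumes "x \<in> carrier L1" "y \<in> carrier L2" "y' \<in> carrier L2"
  shows "\<psi> x y \<otimes>\<^bsub>L2\<^esub> y' = \<zero>\<^bsub>L2\<^esub>" "y' \<otimes>\<^bsub>L2\<^esub> \<psi> x y = \<zero>\<^bsub>L2\<^esub>"
  using assms \<psi>_mem[of x y] L2.skew[of y' "\<psi> x y"]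
  by (auto simp: common_Z_def lie_center_def)

text \<open>The values of \<psi> lie in \<open>R\<close>, where \<alpha> is the bracket of
  \<open>L1\<close>, and they are central in \<open>L1\<close>.\<close>

lemma \<alpha>_\<psi>:
  assumes "x \<in> carrier L1" "y \<in> carrier L2" "x' \<in> carrier L1"
  shows "\<alpha> x' (\<psi> x y) = \<zero>\<^bsub>L2\<^esub>"
  using assms by (simp add: \<alpha>_right \<psi>_prod_L1)

lemma \<psi>_add_right:
  assumes "x \<in> carrier L1" "y \<in> carrier L2" "y' \<in> carrier L2"
  shows "\<psi> x (y \<oplus>\<^bsub>L2\<^esub> y') = \<psi> x y \<oplus>\<^bsub>L2\<^esub> \<psi> x y'"
  using \<pi>_mem[OF assms(1)] assms(2,3)
  by (auto simp: psi'_def Hom_quot_Z_def hom_space_def linear_maps_def I2.carrier_quotient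
      I2.add_quotient[symmetric])

lemma \<psi>_scale_right:
  assumes "x \<in> carrier L1" "y \<in> carrier L2"
  shows "\<psi> x (c \<odot>\<^bsub>L2\<^esub> y) = c \<odot>\<^bsub>L2\<^esub> \<psi> x y"
  using \<pi>_mem[OF assms(1)] assms(2)
  by (auto simp: psi'_def Hom_quot_Z_def hom_space_def linear_maps_def I2.carrier_quotient
      I2.scale_quotient[symmetric])

lemma \<psi>_add_left:
  assumes "x \<in> carrier L1" "x' \<in> carrier L1" "y \<in> carrier L2"
  shows "\<psi> (x \<oplus>\<^bsub>L1\<^esub> x') y = \<psi> x y \<oplus>\<^bsub>L2\<^esub> \<psi> x' y"
proof -
  have "\<pi> (R +>\<^bsub>L1\<^esub> (x \<oplus>\<^bsub>L1\<^esub> x')) =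
      \<pi> (R +>\<^bsub>L1\<^esub> x) \<oplus>\<^bsub>Hom_quot_Z L1 L2 R\<^esub> \<pi> (R +>\<^bsub>L1\<^esub> x')"
    using \<pi>_linear assms
    by (auto simp: linear_maps_def I1.carrier_quotient I1.add_quotient[symmetric])
  then show ?thesis
    using assms by (simp add: psi'_def Hom_quot_Z_def hom_space_def I2.carrier_quotient)
qed

lemma \<psi>_scale_left:
  assumes "x \<in> carrier L1" "y \<in> carrier L2"
  shows "\<psi> (c \<odot>\<^bsub>L1\<^esub> x) y = c \<odot>\<^bsub>L2\<^esub> \<psi> x y"
proof -
  have "\<pi> (R +>\<^bsub>L1\<^esub> (c \<odot>\<^bsub>L1\<^esub> x)) = c \<odot>\<^bsub>Hom_quot_Z L1 L2 R\<^esub> \<pi> (R +>\<^bsub>L1\<^esub> x)"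
    using \<pi>_linear assms
    by (auto simp: linear_maps_def I1.carrier_quotient I1.scale_quotient[symmetric])
  then show ?thesis
    using assms by (simp add: psi'_def Hom_quot_Z_def hom_space_def I2.carrier_quotient)
qed

lemma \<psi>_minus_right:
  "\<lbrakk>x \<in> carrier L1; y \<in> carrier L2\<rbrakk> \<Longrightarrow> \<psi> x (\<ominus>\<^bsub>L2\<^esub> y) = \<ominus>\<^bsub>L2\<^esub> \<psi> x y"
  by (simp add: L2.minus_eq_scale \<psi>_scale_right)

lemma \<psi>_R_left:
  assumes "a \<in> R" "y \<in> carrier L2"
  shows "\<psi> a y = \<zero>\<^bsub>L2\<^esub>"
proof -
  \<comment> \<open>All elements of \<open>R\<close> have the same coset, so \<open>a\<close> may be
    replaced by its multiple by 0; homogeneity then makes the value zero.\<close>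
  have "\<psi> a y = \<psi> (0 \<odot>\<^bsub>L1\<^esub> a) y"
    using assms by (simp add: psi'_def I1.I.a_rcos_const I1.coset_zero)
  then show ?thesis
    using assms by (simp only: \<psi>_scale_left R_L1) simp
qed

lemma \<psi>_R_right:
  assumes "x \<in> carrier L1" "a \<in> R"
  shows "\<psi> x a = \<zero>\<^bsub>L2\<^esub>"
proof -
  have "\<psi> x a = \<psi> x (0 \<odot>\<^bsub>L2\<^esub> a)"
    using assms by (simp add: psi'_def I2.I.a_rcos_const I2.coset_zero)
  then show ?thesis
    using assms by (simp only: \<psi>_scale_right R_L2) simp
qed

text \<open>Equivariance of \<pi>, evaluated at the cosets of x' and y. The sign is that of the
  contragredient action on the Hom space.\<close>

lemma \<psi>_equivariant:
  assumes "x \<in> carrier L1" "x' \<in> carrier L1" "y \<in> carrier L2"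
  shows "\<psi> (x \<otimes>\<^bsub>L1\<^esub> x') y = \<ominus>\<^bsub>L2\<^esub> \<psi> x' (\<alpha> x y)"
proof -
  have "induced L1 R (\<lambda>z. x \<otimes>\<^bsub>L1\<^esub> z) (R +>\<^bsub>L1\<^esub> x') = R +>\<^bsub>L1\<^esub> (x \<otimes>\<^bsub>L1\<^esub> x')"
    using assms by (intro I1.induced_coset) (simp_all add: L1.prod_add_right I1.ideal_prod_right)
  moreover have "induced L2 R (\<alpha> x) (R +>\<^bsub>L2\<^esub> y) = R +>\<^bsub>L2\<^esub> (\<alpha> x y)"
    using assms by (intro I2.induced_coset) (simp_all add: \<alpha>_add_right \<alpha>_preserves_R)
  ultimately show ?thesis
    using \<pi>_equivariant[of x "R +>\<^bsub>L1\<^esub> x'"] assms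
    by (simp add: psi'_def hom_action_def I1.carrier_quotient I2.carrier_quotient)
qed

text \<open>This is commutativity of \<open>L2/R\<close>. Together with
  \<open>\<psi>_R_right\<close> it makes \<psi> vanish whenever its second argument is a product in
  \<open>L2\<close>.\<close>

lemma prod_L2_in_R:
  assumes "y \<in> carrier L2" "y' \<in> carrier L2"
  shows "y \<otimes>\<^bsub>L2\<^esub> y' \<in> R"
proof -
  have "R +>\<^bsub>L2\<^esub> (y \<otimes>\<^bsub>L2\<^esub> y') = R"
    using quotient_abelian assms
    by (simp add: abelian_algebra_def I2.carrier_quotient I2.prod_quotient I2.zero_quotient)
  then show ?thesis
    using assms by (simp add: I2.coset_eq_ideal_iff)
qed

text \<open>The hypothesis says that \<pi> takes values at the coset of \<open>x\<close> and at the
  zero coset that agree on \<open>L2/R\<close>. Elements of the Hom space are extensional, so the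
  two values are equal as functions, and injectivity of \<pi> applies.\<close>

lemma \<psi>_left_nondegenerate:
  assumes x: "x \<in> carrier L1" and "\<And>y. y \<in> carrier L2 \<Longrightarrow> \<psi> x y = \<zero>\<^bsub>L2\<^esub>"
  shows "x \<in> R"
proof -
  have "\<pi> (R +>\<^bsub>L1\<^esub> x) = \<pi> (R +>\<^bsub>L1\<^esub> \<zero>\<^bsub>L1\<^esub>)"
  proof (rule extensionalityI)
    show "\<pi> (R +>\<^bsub>L1\<^esub> x) \<in> extensional (carrier (quotient_algebra L2 R))"
      "\<pi> (R +>\<^bsub>L1\<^esub> \<zero>\<^bsub>L1\<^esub>) \<in> extensional (carrier (quotient_algebra L2 R))"
      using \<pi>_mem[OF x] \<pi>_mem[of "\<zero>\<^bsub>L1\<^esub>"] by (auto simp: Hom_quot_Z_def hom_space_def)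
    fix v assume "v \<in> carrier (quotient_algebra L2 R)"
    then obtain y where "y \<in> carrier L2" "v = R +>\<^bsub>L2\<^esub> y"
      by (auto simp: I2.carrier_quotient)
    then show "\<pi> (R +>\<^bsub>L1\<^esub> x) v = \<pi> (R +>\<^bsub>L1\<^esub> \<zero>\<^bsub>L1\<^esub>) v"
      using assms \<psi>_R_left[of "\<zero>\<^bsub>L1\<^esub>" y] by (simp add: psi'_def)
  qed
  then have "R +>\<^bsub>L1\<^esub> x = R +>\<^bsub>L1\<^esub> \<zero>\<^bsub>L1\<^esub>"
    using \<pi>_inj x by (auto simp: I1.carrier_quotient dest: inj_onD)
  then show ?thesis
    using x by (simp add: I1.coset_zero I1.coset_eq_ideal_iff)
qed

text \<open>The condition that the image of \<pi> annihilates no nonzero vector of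
  \<open>L2/R\<close>, read on representatives.\<close>

lemma \<psi>_right_nondegenerate:
  assumes y: "y \<in> carrier L2" and "\<And>x. x \<in> carrier L1 \<Longrightarrow> \<psi> x y = \<zero>\<^bsub>L2\<^esub>"
  shows "y \<in> R"
proof -
  have "R +>\<^bsub>L2\<^esub> y = R"
    using \<pi>_nondegenerate[of "R +>\<^bsub>L2\<^esub> y"] assms
    by (auto simp: I1.carrier_quotient I2.carrier_quotient I2.zero_quotient psi'_def)
  then show ?thesis
    using y by (simp add: I2.coset_eq_ideal_iff)
qed

end

section \<open>The algebra on the direct sum and its quotient\<close>

text \<open>Naming the identity at a single triple turns its additivity in each argument into rules
  that can be applied backwards.\<close>

definition leibniz_at :: "(complex, 'a) module \<Rightarrow> 'a \<Rightarrow> 'a \<Rightarrow> 'a \<Rightarrow> bool" where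
  "leibniz_at A a b c \<longleftrightarrow>
    a \<otimes>\<^bsub>A\<^esub> (b \<otimes>\<^bsub>A\<^esub> c) = (a \<otimes>\<^bsub>A\<^esub> b) \<otimes>\<^bsub>A\<^esub> c \<oplus>\<^bsub>A\<^esub> b \<otimes>\<^bsub>A\<^esub> (a \<otimes>\<^bsub>A\<^esub> c)"

context complex_algebra
begin

text \<open>Both sides of the identity are additive in each of the three arguments, so it may be
  checked on summands.\<close>

lemma leibniz_at_add:
  assumes "a \<in> carrier A" "a' \<in> carrier A" "b \<in> carrier A" "c \<in> carrier A"
  shows "leibniz_at A a b c \<Longrightarrow> leibniz_at A a' b c \<Longrightarrow> leibniz_at A (a \<oplus> a') b c"
    and "leibniz_at A b a c \<Longrightarrow> leibniz_at A b a' c \<Longrightarrow> leibniz_at A b (a \<oplus> a') c"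
    and "leibniz_at A b c a \<Longrightarrow> leibniz_at A b c a' \<Longrightarrow> leibniz_at A b c (a \<oplus> a')"
  using assms by (simp_all add: leibniz_at_def prod_add_left prod_add_right M.a_ac)

end

section \<open>The direct sum as a finite-dimensional algebra\<close>

context leibniz_data
begin

abbreviation "M \<equiv> M_alg L1 L2 R \<alpha> \<pi>"
abbreviation "D \<equiv> D_ideal L2 R"
abbreviation "Mt \<equiv> M_tilde L1 L2 R \<alpha> \<pi>"

lemma M_simps [simp]:
  "carrier M = carrier L1 \<times> carrier L2"
  "\<zero>\<^bsub>M\<^esub> = (\<zero>\<^bsub>L1\<^esub>, \<zero>\<^bsub>L2\<^esub>)"
  "(x, y) \<oplus>\<^bsub>M\<^esub> (x', y') = (x \<oplus>\<^bsub>L1\<^esub> x', y \<oplus>\<^bsub>L2\<^esub> y')"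
  "c \<odot>\<^bsub>M\<^esub> (x, y) = (c \<odot>\<^bsub>L1\<^esub> x, c \<odot>\<^bsub>L2\<^esub> y)"
  "(x, y) \<otimes>\<^bsub>M\<^esub> (x', y') = (x \<otimes>\<^bsub>L1\<^esub> x',
    (\<alpha> x y' \<ominus>\<^bsub>L2\<^esub> \<alpha> x' y) \<oplus>\<^bsub>L2\<^esub> y \<otimes>\<^bsub>L2\<^esub> y' \<oplus>\<^bsub>L2\<^esub> \<psi> x' y)"
  by (simp_all add: M_alg_def)

lemma M_space: "complex_space M"
proof (intro complex_space.intro moduleI)
  show "cring (ring_of_type_algebra :: complex ring)" ..
  show "abelian_group M"
  proof (rule abelian_groupI)
    fix u assume "u \<in> carrier M"
    then show "\<exists>v\<in>carrier M. v \<oplus>\<^bsub>M\<^esub> u = \<zero>\<^bsub>M\<^esub>"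
      by (intro bexI[of _ "(\<ominus>\<^bsub>L1\<^esub> fst u, \<ominus>\<^bsub>L2\<^esub> snd u)"]) (auto simp: L1.M.l_neg L2.M.l_neg)
  qed (auto simp: L1.M.a_ac L2.M.a_ac)
qed (auto simp: L1.add_scale L2.add_scale L1.scale_add L2.scale_add L1.scale_scale L2.scale_scale)

text \<open>Spanning sets of the summands, embedded in \<open>M\<close>, together span it: each
  inclusion is linear and maps into the span of their union \<open>T\<close>.\<close>

lemma M_finite_dimensional:
  "\<exists>B. finite B \<and> B \<subseteq> carrier M \<and> (\<forall>u\<in>carrier M. \<exists>c. u = (\<Oplus>\<^bsub>M\<^esub>b\<in>B. c b \<odot>\<^bsub>M\<^esub> b))"
proof -
  interpret M: complex_space M by (rule M_space)
  obtain B1 B2 where B1: "finite B1" "B1 \<subseteq> carrier L1" "carrier L1 \<subseteq> L1.lin_span B1"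
    and B2: "finite B2" "B2 \<subseteq> carrier L2" "carrier L2 \<subseteq> L2.lin_span B2"
    using L1.finite_spanning_set L2.finite_spanning_set by metis
  define T where "T = (\<lambda>x. (x, \<zero>\<^bsub>L2\<^esub>)) ` B1 \<union> (\<lambda>y. (\<zero>\<^bsub>L1\<^esub>, y)) ` B2"
  have T: "finite T" "T \<subseteq> carrier M"
    using B1 B2 by (auto simp: T_def)
  have "u \<in> M.lin_span T" if u: "u \<in> carrier M" for u
  proof -
    obtain x y where u: "u = (x, y)" "x \<in> carrier L1" "y \<in> carrier L2"
      using u by auto
    have "(x, \<zero>\<^bsub>L2\<^esub>) \<in> M.lin_span T"
      using L1.linear_image_in_span[OF M_space, of "\<lambda>x. (x, \<zero>\<^bsub>L2\<^esub>)" B1 T x] B1 T u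
      by (auto simp: T_def linear_maps_def)
    moreover have "(\<zero>\<^bsub>L1\<^esub>, y) \<in> M.lin_span T"
      using L2.linear_image_in_span[OF M_space, of "\<lambda>y. (\<zero>\<^bsub>L1\<^esub>, y)" B2 T y] B2 T u
      by (auto simp: T_def linear_maps_def)
    ultimately show ?thesis
      using M.lin_span_add[OF T(2)] u by fastforce
  qed
  then show ?thesis
    using T by (auto simp: M.lin_span_def intro!: exI[of _ T])
qed

text \<open>Every term of the product formula is bilinear in the two factors, by bilinearity of the
  brackets, \<alpha> and \<psi>.\<close>

sublocale M: complex_algebra M
proof -
  interpret M: complex_space M by (rule M_space)
  note additive = L1.prod_add_left L1.prod_add_right L2.prod_add_left L2.prod_add_right
    \<alpha>_add_left \<alpha>_add_right \<psi>_add_left \<psi>_add_right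
  note homogeneous = L1.prod_smult_left L1.prod_smult_right L2.prod_smult_left L2.prod_smult_right
    \<alpha>_scale_left \<alpha>_scale_right \<psi>_scale_left \<psi>_scale_right
  show "complex_algebra M"
  proof unfold_locales
    fix u v assume uv: "u \<in> carrier M" "v \<in> carrier M"
    then show "u \<otimes>\<^bsub>M\<^esub> v \<in> carrier M"
      by auto
    show "(c \<odot>\<^bsub>M\<^esub> u) \<otimes>\<^bsub>M\<^esub> v = c \<odot>\<^bsub>M\<^esub> (u \<otimes>\<^bsub>M\<^esub> v)"
      "u \<otimes>\<^bsub>M\<^esub> (c \<odot>\<^bsub>M\<^esub> v) = c \<odot>\<^bsub>M\<^esub> (u \<otimes>\<^bsub>M\<^esub> v)" for c
      using uv by (auto simp: homogeneous L2.scale_add a_minus_def L2.scale_minus_right)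
    fix w assume "w \<in> carrier M"
    then show "(u \<oplus>\<^bsub>M\<^esub> v) \<otimes>\<^bsub>M\<^esub> w = u \<otimes>\<^bsub>M\<^esub> w \<oplus>\<^bsub>M\<^esub> v \<otimes>\<^bsub>M\<^esub> w"
      "w \<otimes>\<^bsub>M\<^esub> (u \<oplus>\<^bsub>M\<^esub> v) = w \<otimes>\<^bsub>M\<^esub> u \<oplus>\<^bsub>M\<^esub> w \<otimes>\<^bsub>M\<^esub> v"
      using uv by (auto simp: additive a_minus_def L2.M.minus_add L2.M.a_ac)
  qed (use M_finite_dimensional in auto)
qed

section \<open>The Leibniz identity and left centrality on the direct sum\<close>

lemma embed_prods:
  assumes "x \<in> carrier L1" "x' \<in> carrier L1" "y \<in> carrier L2" "y' \<in> carrier L2"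
  shows "(x, \<zero>\<^bsub>L2\<^esub>) \<otimes>\<^bsub>M\<^esub> (x', \<zero>\<^bsub>L2\<^esub>) = (x \<otimes>\<^bsub>L1\<^esub> x', \<zero>\<^bsub>L2\<^esub>)"
    and "(x, \<zero>\<^bsub>L2\<^esub>) \<otimes>\<^bsub>M\<^esub> (\<zero>\<^bsub>L1\<^esub>, y) = (\<zero>\<^bsub>L1\<^esub>, \<alpha> x y)"
    and "(\<zero>\<^bsub>L1\<^esub>, y) \<otimes>\<^bsub>M\<^esub> (x, \<zero>\<^bsub>L2\<^esub>) = (\<zero>\<^bsub>L1\<^esub>, \<ominus>\<^bsub>L2\<^esub> \<alpha> x y \<oplus>\<^bsub>L2\<^esub> \<psi> x y)"
    and "(\<zero>\<^bsub>L1\<^esub>, y) \<otimes>\<^bsub>M\<^esub> (\<zero>\<^bsub>L1\<^esub>, y') = (\<zero>\<^bsub>L1\<^esub>, y \<otimes>\<^bsub>L2\<^esub> y')"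
  using assms by (simp_all add: a_minus_def \<psi>_R_left \<psi>_R_right)

text \<open>By \<open>embed_prods\<close>, \<psi> enters only through the product of an element of
  \<open>L2\<close> with an element of \<open>L1\<close>, in this order. Its terms are therefore
  few, and in each case they vanish or are matched by equivariance.\<close>

lemma M_leibniz_at_components:
  assumes "x \<in> carrier L1" "x' \<in> carrier L1" "x'' \<in> carrier L1"
    "y \<in> carrier L2" "y' \<in> carrier L2" "y'' \<in> carrier L2"
  shows "leibniz_at M (x, \<zero>\<^bsub>L2\<^esub>) (x', \<zero>\<^bsub>L2\<^esub>) (x'', \<zero>\<^bsub>L2\<^esub>)"
    and "leibniz_at M (x, \<zero>\<^bsub>L2\<^esub>) (x', \<zero>\<^bsub>L2\<^esub>) (\<zero>\<^bsub>L1\<^esub>, y)"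
    and "leibniz_at M (x, \<zero>\<^bsub>L2\<^esub>) (\<zero>\<^bsub>L1\<^esub>, y) (x', \<zero>\<^bsub>L2\<^esub>)"
    and "leibniz_at M (x, \<zero>\<^bsub>L2\<^esub>) (\<zero>\<^bsub>L1\<^esub>, y) (\<zero>\<^bsub>L1\<^esub>, y')"
    and "leibniz_at M (\<zero>\<^bsub>L1\<^esub>, y) (x, \<zero>\<^bsub>L2\<^esub>) (x', \<zero>\<^bsub>L2\<^esub>)"
    and "leibniz_at M (\<zero>\<^bsub>L1\<^esub>, y) (x, \<zero>\<^bsub>L2\<^esub>) (\<zero>\<^bsub>L1\<^esub>, y')"
    and "leibniz_at M (\<zero>\<^bsub>L1\<^esub>, y) (\<zero>\<^bsub>L1\<^esub>, y') (x, \<zero>\<^bsub>L2\<^esub>)"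
    and "leibniz_at M (\<zero>\<^bsub>L1\<^esub>, y) (\<zero>\<^bsub>L1\<^esub>, y') (\<zero>\<^bsub>L1\<^esub>, y'')"
proof -
  \<comment> \<open>The product formula for arbitrary pairs, \<open>M_simps(5)\<close>, is withheld
    in each case so that products of embedded elements are rewritten by the shorter
    \<open>embed_prods\<close>.\<close>
  note expand = leibniz_at_def embed_prods \<alpha>_add_right \<alpha>_minus_right \<psi>_add_right \<psi>_minus_right
    L2.prod_add_left L2.prod_add_right L2.prod_minus_left L2.prod_minus_right
    \<alpha>_\<psi> \<psi>_prod_L2 \<psi>_R_right \<psi>_equivariant \<alpha>_derivation \<alpha>_bracket prod_L2_in_R
    a_minus_def L2.M.minus_add
  \<comment> \<open>Sorting with \<open>a_ac\<close> can leave a term and its negative separated by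
    one summand; \<open>cancel_middle\<close> covers this situation.\<close>
  note cancel = L2.M.r_neg L2.M.l_neg L2.M.r_neg1 L2.M.r_neg2 L2.M.cancel_middle
  show "leibniz_at M (x, \<zero>\<^bsub>L2\<^esub>) (x', \<zero>\<^bsub>L2\<^esub>) (x'', \<zero>\<^bsub>L2\<^esub>)"
    using assms by (simp add: expand L1.leibniz[of x x' x''] del: M_simps(5))
  show "leibniz_at M (x, \<zero>\<^bsub>L2\<^esub>) (x', \<zero>\<^bsub>L2\<^esub>) (\<zero>\<^bsub>L1\<^esub>, y)"
    using assms by (simp add: expand L2.M.a_ac cancel del: M_simps(5))
  \<comment> \<open>Both products on the right contribute a \<psi>-term; equivariance makes the two
    cancel.\<close>
  show "leibniz_at M (x, \<zero>\<^bsub>L2\<^esub>) (\<zero>\<^bsub>L1\<^esub>, y) (x', \<zero>\<^bsub>L2\<^esub>)"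
    using assms by (simp add: expand L2.M.a_ac cancel del: M_simps(5))
  show "leibniz_at M (x, \<zero>\<^bsub>L2\<^esub>) (\<zero>\<^bsub>L1\<^esub>, y) (\<zero>\<^bsub>L1\<^esub>, y')"
    using assms by (simp add: expand L2.M.a_ac cancel del: M_simps(5))
  \<comment> \<open>Here one \<psi>-term remains on each side, and equivariance identifies
    them.\<close>
  show "leibniz_at M (\<zero>\<^bsub>L1\<^esub>, y) (x, \<zero>\<^bsub>L2\<^esub>) (x', \<zero>\<^bsub>L2\<^esub>)"
    using assms by (simp add: expand L2.M.a_ac cancel del: M_simps(5))
  show "leibniz_at M (\<zero>\<^bsub>L1\<^esub>, y) (x, \<zero>\<^bsub>L2\<^esub>) (\<zero>\<^bsub>L1\<^esub>, y')"
    using assms by (simp add: expand L2.M.a_ac cancel del: M_simps(5))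
  show "leibniz_at M (\<zero>\<^bsub>L1\<^esub>, y) (\<zero>\<^bsub>L1\<^esub>, y') (x, \<zero>\<^bsub>L2\<^esub>)"
    \<comment> \<open>The derivation rule puts \<open>\<alpha> x y\<close> to the left of y', the
      second product on the right-hand side puts it to the right; skew symmetry matches the
      two.\<close>
    using assms L2.skew[of y' "\<alpha> x y"]
    by (simp add: expand L2.M.a_ac cancel del: M_simps(5))
  show "leibniz_at M (\<zero>\<^bsub>L1\<^esub>, y) (\<zero>\<^bsub>L1\<^esub>, y') (\<zero>\<^bsub>L1\<^esub>, y'')"
    using assms by (simp add: expand L2.leibniz[of y y' y''] del: M_simps(5))
qed

lemma M_split:
  assumes "u \<in> carrier M"
  obtains x y where "x \<in> carrier L1" "y \<in> carrier L2"
    "u = (x, \<zero>\<^bsub>L2\<^esub>) \<oplus>\<^bsub>M\<^esub> (\<zero>\<^bsub>L1\<^esub>, y)"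
  using assms by auto

lemma M_left_leibniz:
  assumes a: "a \<in> carrier M" and b: "b \<in> carrier M" and c: "c \<in> carrier M"
  shows "leibniz_at M a b c"
proof -
  obtain x y where xy: "x \<in> carrier L1" "y \<in> carrier L2"
      "a = (x, \<zero>\<^bsub>L2\<^esub>) \<oplus>\<^bsub>M\<^esub> (\<zero>\<^bsub>L1\<^esub>, y)"
    using a by (rule M_split)
  obtain x' y' where xy': "x' \<in> carrier L1" "y' \<in> carrier L2"
      "b = (x', \<zero>\<^bsub>L2\<^esub>) \<oplus>\<^bsub>M\<^esub> (\<zero>\<^bsub>L1\<^esub>, y')"
    using b by (rule M_split)
  obtain x'' y'' where xy'': "x'' \<in> carrier L1" "y'' \<in> carrier L2"
      "c = (x'', \<zero>\<^bsub>L2\<^esub>) \<oplus>\<^bsub>M\<^esub> (\<zero>\<^bsub>L1\<^esub>, y'')"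
    using c by (rule M_split)
  show ?thesis
    unfolding xy(3) xy'(3) xy''(3)
    \<comment> \<open>The additivity rules split all three sums and leave exactly the eight
      component cases.\<close>
    by (intro M.leibniz_at_add M_leibniz_at_components M.M.a_closed)
      (use xy(1,2) xy'(1,2) xy''(1,2) in auto)
qed

lemma M_left_central_leibniz: "left_central_leibniz_algebra M"
proof unfold_locales
  fix a b c assume "a \<in> carrier M" "b \<in> carrier M" "c \<in> carrier M"
  then show "a \<otimes>\<^bsub>M\<^esub> (b \<otimes>\<^bsub>M\<^esub> c) = (a \<otimes>\<^bsub>M\<^esub> b) \<otimes>\<^bsub>M\<^esub> c \<oplus>\<^bsub>M\<^esub> b \<otimes>\<^bsub>M\<^esub> (a \<otimes>\<^bsub>M\<^esub> c)"
    using M_left_leibniz[of a b c] unfolding leibniz_at_def by blast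
next
  fix a b assume "a \<in> carrier M" "b \<in> carrier M"
  then obtain x y x' y' where ab: "a = (x, y)" "x \<in> carrier L1" "y \<in> carrier L2"
      "b = (x', y')" "x' \<in> carrier L1" "y' \<in> carrier L2"
    by auto
  \<comment> \<open>The \<alpha>-term occurs with both signs and the brackets are alternating, so a
    square has only its central \<psi>-part, which every left multiplication kills.\<close>
  have "b \<otimes>\<^bsub>M\<^esub> b = (\<zero>\<^bsub>L1\<^esub>, \<psi> x' y')"
    using ab by (simp add: L1.alternating L2.alternating a_minus_def L2.M.r_neg)
  then show "a \<otimes>\<^bsub>M\<^esub> (b \<otimes>\<^bsub>M\<^esub> b) = \<zero>\<^bsub>M\<^esub>"
    using ab by (simp add: \<alpha>_\<psi> \<psi>_prod_L2 \<psi>_R_left a_minus_def)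
qed

section \<open>The ideal \<open>D\<close>\<close>

lemma M_minus: "\<lbrakk>x \<in> carrier L1; y \<in> carrier L2\<rbrakk> \<Longrightarrow> \<ominus>\<^bsub>M\<^esub> (x, y) = (\<ominus>\<^bsub>L1\<^esub> x, \<ominus>\<^bsub>L2\<^esub> y)"
  by (simp add: M.minus_eq_scale L1.minus_eq_scale L2.minus_eq_scale)

sublocale D: algebra_ideal M D
proof (unfold_locales, unfold two_sided_ideal_def, intro conjI ballI)
  show "submodule D ring_of_type_algebra M"
  proof (rule M.submoduleI)
    show "\<zero>\<^bsub>M\<^esub> \<in> D"
      using I1.I.zero_closed by (auto simp: D_ideal_def common_zero)
  qed (auto simp: D_ideal_def M_minus common_minus common_add common_smult L2.M.minus_add
      L2.scale_minus_right I2.ideal_scale)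
  fix u d assume "u \<in> carrier M" "d \<in> D"
  then obtain x y a where u: "u = (x, y)" "x \<in> carrier L1" "y \<in> carrier L2"
    and d: "d = (a, \<ominus>\<^bsub>L2\<^esub> a)" "a \<in> R"
    by (auto simp: D_ideal_def)
  \<comment> \<open>On \<open>R\<close> both descriptions of \<alpha> apply: acting on
    \<open>a\<close> it is the bracket of \<open>L1\<close>, and the action of \<open>a\<close> on
    \<open>y\<close> is the bracket of \<open>L2\<close>. The latter cancels against the product of
    \<open>y\<close> with the negative of \<open>a\<close>, by skew symmetry; the \<psi>-term
    vanishes because \<open>a\<close> lies in \<open>R\<close>.\<close>
  have "u \<otimes>\<^bsub>M\<^esub> d = (x \<otimes>\<^bsub>L1\<^esub> a, \<ominus>\<^bsub>L2\<^esub> (x \<otimes>\<^bsub>L1\<^esub> a))"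
    using u d L2.skew[of a y]
    by (simp add: \<alpha>_minus_right \<alpha>_left \<alpha>_right[of x a] a_minus_def L2.prod_minus_right \<psi>_R_left I1.ideal_prod_right
        L2.M.a_ac L2.M.cancel_middle)
  then show "u \<otimes>\<^bsub>M\<^esub> d \<in> D"
    using u d by (auto simp: D_ideal_def I1.ideal_prod_right)
  have "d \<otimes>\<^bsub>M\<^esub> u = (a \<otimes>\<^bsub>L1\<^esub> x, x \<otimes>\<^bsub>L1\<^esub> a)"
    using u d
    by (simp add: \<alpha>_minus_right \<alpha>_left \<alpha>_right[of x a] a_minus_def L2.prod_minus_left \<psi>_R_right I1.ideal_prod_right
        L2.M.a_ac L2.M.r_neg)
  also have "x \<otimes>\<^bsub>L1\<^esub> a = \<ominus>\<^bsub>L2\<^esub> (a \<otimes>\<^bsub>L1\<^esub> x)"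
    using u d L1.skew[of x a] by (simp add: common_minus I1.ideal_prod_left)
  finally show "d \<otimes>\<^bsub>M\<^esub> u \<in> D"
    using u d by (auto simp: D_ideal_def I1.ideal_prod_left)
qed

section \<open>The radical of the quotient and its identification with \<open>R\<close>\<close>

lemma mem_D_iff: "(x, y) \<in> D \<longleftrightarrow> x \<in> R \<and> y = \<ominus>\<^bsub>L2\<^esub> x"
  by (auto simp: D_ideal_def)

lemma sym_prod_M:
  assumes "x \<in> carrier L1" "y \<in> carrier L2" "x' \<in> carrier L1" "y' \<in> carrier L2"
  shows "(x, y) \<otimes>\<^bsub>M\<^esub> (x', y') \<oplus>\<^bsub>M\<^esub> (x', y') \<otimes>\<^bsub>M\<^esub> (x, y) =
    (\<zero>\<^bsub>L1\<^esub>, \<psi> x' y \<oplus>\<^bsub>L2\<^esub> \<psi> x y')"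
  using assms L1.skew[of x x'] L2.skew[of y' y]
    L2.M.cancel_opposite_terms[of "\<alpha> x y'" "\<alpha> x' y" "y \<otimes>\<^bsub>L2\<^esub> y'" "\<psi> x' y" "\<psi> x y'"]
  by (simp add: a_minus_def L1.M.l_neg)

lemma carrier_Mt: "carrier Mt = (+>\<^bsub>M\<^esub>) D ` (carrier L1 \<times> carrier L2)"
  using D.carrier_quotient by (simp add: M_tilde_def)

text \<open>A symmetrized product has first component zero, so it lies in \<open>D\<close> only if
  it is zero. Putting x' or y' equal to zero separates its two \<psi>-terms, and each nondegeneracy
  statement settles one coordinate; conversely \<psi> vanishes on \<open>R\<close> in either
  argument.\<close>

lemma coset_mem_radical_iff:
  assumes "x \<in> carrier L1" "y \<in> carrier L2"
  shows "D +>\<^bsub>M\<^esub> (x, y) \<in> leibniz_radical Mt \<longleftrightarrow> x \<in> R \<and> y \<in> R"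
proof -
  have sym: "(D +>\<^bsub>M\<^esub> (x, y)) \<otimes>\<^bsub>Mt\<^esub> (D +>\<^bsub>M\<^esub> (x', y')) \<oplus>\<^bsub>Mt\<^esub>
      (D +>\<^bsub>M\<^esub> (x', y')) \<otimes>\<^bsub>Mt\<^esub> (D +>\<^bsub>M\<^esub> (x, y)) = \<zero>\<^bsub>Mt\<^esub> \<longleftrightarrow>
      \<psi> x' y \<oplus>\<^bsub>L2\<^esub> \<psi> x y' = \<zero>\<^bsub>L2\<^esub>"
    if "x' \<in> carrier L1" "y' \<in> carrier L2" for x' y'
  proof -
    have "(D +>\<^bsub>M\<^esub> (x, y)) \<otimes>\<^bsub>Mt\<^esub> (D +>\<^bsub>M\<^esub> (x', y')) \<oplus>\<^bsub>Mt\<^esub>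
        (D +>\<^bsub>M\<^esub> (x', y')) \<otimes>\<^bsub>Mt\<^esub> (D +>\<^bsub>M\<^esub> (x, y)) =
        D +>\<^bsub>M\<^esub> (\<zero>\<^bsub>L1\<^esub>, \<psi> x' y \<oplus>\<^bsub>L2\<^esub> \<psi> x y')"
      using assms that sym_prod_M[of x y x' y']
        M.prod_closed[of "(x, y)" "(x', y')"] M.prod_closed[of "(x', y')" "(x, y)"]
      by (simp only: M_tilde_def D.prod_quotient D.add_quotient M_simps(1) SigmaI)
    moreover have "D +>\<^bsub>M\<^esub> (\<zero>\<^bsub>L1\<^esub>, \<psi> x' y \<oplus>\<^bsub>L2\<^esub> \<psi> x y') = \<zero>\<^bsub>Mt\<^esub> \<longleftrightarrow>
        (\<zero>\<^bsub>L1\<^esub>, \<psi> x' y \<oplus>\<^bsub>L2\<^esub> \<psi> x y') \<in> D"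
      unfolding M_tilde_def D.zero_quotient using assms that by (simp add: D.coset_eq_ideal_iff)
    ultimately show ?thesis
      by (simp add: mem_D_iff common_zero)
  qed
  have "D +>\<^bsub>M\<^esub> (x, y) \<in> leibniz_radical Mt \<longleftrightarrow>
      (\<forall>x'\<in>carrier L1. \<forall>y'\<in>carrier L2. \<psi> x' y \<oplus>\<^bsub>L2\<^esub> \<psi> x y' = \<zero>\<^bsub>L2\<^esub>)"
    using assms by (auto simp: leibniz_radical_def carrier_Mt sym)
  also have "\<dots> \<longleftrightarrow> x \<in> R \<and> y \<in> R"
  proof
    assume H: "\<forall>x'\<in>carrier L1. \<forall>y'\<in>carrier L2. \<psi> x' y \<oplus>\<^bsub>L2\<^esub> \<psi> x y' = \<zero>\<^bsub>L2\<^esub>"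
    show "x \<in> R \<and> y \<in> R"
    proof
      show "x \<in> R"
      proof (rule \<psi>_left_nondegenerate)
        fix y' assume "y' \<in> carrier L2"
        then show "\<psi> x y' = \<zero>\<^bsub>L2\<^esub>"
          using H[rule_format, of "\<zero>\<^bsub>L1\<^esub>" y'] assms by (simp add: \<psi>_R_left)
      qed fact
      show "y \<in> R"
      proof (rule \<psi>_right_nondegenerate)
        fix x' assume "x' \<in> carrier L1"
        then show "\<psi> x' y = \<zero>\<^bsub>L2\<^esub>"
          using H[rule_format, of x' "\<zero>\<^bsub>L2\<^esub>"] assms by (simp add: \<psi>_R_right)
      qed fact
    qed
  qed (simp add: \<psi>_R_left \<psi>_R_right)
  finally show ?thesis .
qed

lemma radical_Mt: "leibniz_radical Mt = {D +>\<^bsub>M\<^esub> (a, b) | a b. a \<in> R \<and> b \<in> R}"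
proof (intro equalityI subsetI)
  fix U assume U: "U \<in> leibniz_radical Mt"
  then obtain x y where "x \<in> carrier L1" "y \<in> carrier L2" "U = D +>\<^bsub>M\<^esub> (x, y)"
    by (auto simp: leibniz_radical_def carrier_Mt)
  then show "U \<in> {D +>\<^bsub>M\<^esub> (a, b) | a b. a \<in> R \<and> b \<in> R}"
    using U coset_mem_radical_iff by blast
next
  fix U assume "U \<in> {D +>\<^bsub>M\<^esub> (a, b) | a b. a \<in> R \<and> b \<in> R}"
  then show "U \<in> leibniz_radical Mt"
    using coset_mem_radical_iff by auto
qed

text \<open>The two representatives differ by (-b, b), an element of \<open>D\<close>. Hence every
  class from \<open>R \<oplus> R\<close> has a representative with second component zero.\<close>

lemma coset_fold:
  assumes "a \<in> R" "b \<in> R"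
  shows "D +>\<^bsub>M\<^esub> (a, b) = D +>\<^bsub>M\<^esub> (a \<oplus>\<^bsub>L1\<^esub> b, \<zero>\<^bsub>L2\<^esub>)"
proof -
  have "a \<oplus>\<^bsub>L1\<^esub> \<ominus>\<^bsub>L1\<^esub> (a \<oplus>\<^bsub>L1\<^esub> b) = \<ominus>\<^bsub>L1\<^esub> b"
    using assms by (simp add: L1.M.minus_add L1.M.r_neg2)
  then have "(a, b) \<ominus>\<^bsub>M\<^esub> (a \<oplus>\<^bsub>L1\<^esub> b, \<zero>\<^bsub>L2\<^esub>) \<in> D"
    using assms by (simp add: a_minus_def M_minus mem_D_iff common_minus[of b])
  then show ?thesis
    using assms by (simp add: D.coset_eq_iff)
qed

text \<open>This makes the identification of the radical with \<open>R\<close> one of algebras.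
  Injectivity holds because an element of \<open>D\<close> with second component zero is zero,
  surjectivity is \<open>coset_fold\<close>, and the operations are preserved both by the inclusion
  of \<open>L1\<close> in \<open>M\<close> and by passage to cosets.\<close>

lemma R_iso_radical:
  "(\<lambda>a. D +>\<^bsub>M\<^esub> (a, \<zero>\<^bsub>L2\<^esub>)) \<in> algebra_isos (L1\<lparr>carrier := R\<rparr>) (Mt\<lparr>carrier := leibniz_radical Mt\<rparr>)"
proof -
  have "inj_on (\<lambda>a. D +>\<^bsub>M\<^esub> (a, \<zero>\<^bsub>L2\<^esub>)) R"
  proof
    fix a b assume ab: "a \<in> R" "b \<in> R" "D +>\<^bsub>M\<^esub> (a, \<zero>\<^bsub>L2\<^esub>) = D +>\<^bsub>M\<^esub> (b, \<zero>\<^bsub>L2\<^esub>)"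
    then have "\<ominus>\<^bsub>L2\<^esub> (a \<ominus>\<^bsub>L1\<^esub> b) = \<zero>\<^bsub>L2\<^esub>" "a \<ominus>\<^bsub>L1\<^esub> b \<in> R"
      using D.coset_eq_iff[of "(a, \<zero>\<^bsub>L2\<^esub>)" "(b, \<zero>\<^bsub>L2\<^esub>)"]
      by (simp_all add: a_minus_def M_minus mem_D_iff)
    then have "a \<ominus>\<^bsub>L1\<^esub> b = \<zero>\<^bsub>L1\<^esub>"
      using L2.M.minus_minus[of "a \<ominus>\<^bsub>L1\<^esub> b"] by (simp add: common_zero)
    then show "a = b"
      using ab L1.M.minus_equality[of a "\<ominus>\<^bsub>L1\<^esub> b"] by (simp add: a_minus_def)
  qed
  moreover have "(\<lambda>a. D +>\<^bsub>M\<^esub> (a, \<zero>\<^bsub>L2\<^esub>)) ` R = leibniz_radical Mt"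
  proof (intro equalityI subsetI)
    fix U assume "U \<in> leibniz_radical Mt"
    then obtain a b where "a \<in> R" "b \<in> R" "U = D +>\<^bsub>M\<^esub> (a, b)"
      by (auto simp: radical_Mt)
    then show "U \<in> (\<lambda>a. D +>\<^bsub>M\<^esub> (a, \<zero>\<^bsub>L2\<^esub>)) ` R"
      using coset_fold by auto
  qed (auto simp: coset_mem_radical_iff)
  moreover have "D +>\<^bsub>M\<^esub> (a \<oplus>\<^bsub>L1\<^esub> b, \<zero>\<^bsub>L2\<^esub>) =
      (D +>\<^bsub>M\<^esub> (a, \<zero>\<^bsub>L2\<^esub>)) \<oplus>\<^bsub>Mt\<^esub> (D +>\<^bsub>M\<^esub> (b, \<zero>\<^bsub>L2\<^esub>))"
    "D +>\<^bsub>M\<^esub> (a \<otimes>\<^bsub>L1\<^esub> b, \<zero>\<^bsub>L2\<^esub>) =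
      (D +>\<^bsub>M\<^esub> (a, \<zero>\<^bsub>L2\<^esub>)) \<otimes>\<^bsub>Mt\<^esub> (D +>\<^bsub>M\<^esub> (b, \<zero>\<^bsub>L2\<^esub>))"
    "D +>\<^bsub>M\<^esub> (c \<odot>\<^bsub>L1\<^esub> a, \<zero>\<^bsub>L2\<^esub>) = c \<odot>\<^bsub>Mt\<^esub> (D +>\<^bsub>M\<^esub> (a, \<zero>\<^bsub>L2\<^esub>))"
    if "a \<in> R" "b \<in> R" for a b c
    using that D.add_quotient[of "(a, \<zero>\<^bsub>L2\<^esub>)" "(b, \<zero>\<^bsub>L2\<^esub>)"]
      D.prod_quotient[of "(a, \<zero>\<^bsub>L2\<^esub>)" "(b, \<zero>\<^bsub>L2\<^esub>)"] D.scale_quotient[of "(a, \<zero>\<^bsub>L2\<^esub>)" c]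
      embed_prods(1)[of a b "\<zero>\<^bsub>L2\<^esub>" "\<zero>\<^bsub>L2\<^esub>"]
    by (simp_all add: M_tilde_def del: M_simps(5))
  ultimately show ?thesis
    by (auto simp: algebra_isos_def algebra_homs_def linear_maps_def bij_betw_def)
qed

end

theorem lemma7:
  fixes L1 L2 :: "(complex, 'a) module" and R :: "'a set"
    and \<alpha> :: "'a \<Rightarrow> 'a \<Rightarrow> 'a" and \<pi> :: "'a set \<Rightarrow> 'a set \<Rightarrow> 'a"
  assumes "leibniz_data L1 L2 R \<alpha> \<pi>"
  shows "let M = M_alg L1 L2 R \<alpha> \<pi>; D = D_ideal L2 R; Mt = M_tilde L1 L2 R \<alpha> \<pi> in
    left_central_leibniz_algebra Mt \<and>
    leibniz_radical Mt = {D +>\<^bsub>M\<^esub> (a, b) | a b. a \<in> R \<and> b \<in> R} \<and>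
    (\<lambda>a. D +>\<^bsub>M\<^esub> (a, \<zero>\<^bsub>L2\<^esub>)) \<in> algebra_isos (L1\<lparr>carrier := R\<rparr>) (Mt\<lparr>carrier := leibniz_radical Mt\<rparr>)"
proof -
  interpret leibniz_data L1 L2 R \<alpha> \<pi> by fact
  show ?thesis
    unfolding Let_def
    using D.quotient_left_central_leibniz[OF M_left_central_leibniz] radical_Mt R_iso_radical
    by (simp add: M_tilde_def)
qed

end
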